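(* Let $k$ be a field of characteristic different from $2$. The quantum double $D(H(2))$ of $H(2)$ is the unital algebra generated by $X$ and $Y$ with relations $$X^2=1,\qquad Y^2=X,\qquad XY=YX.$$ The coalgebra structure on $D(H(2))$ is given by $$\Delta(X)=X\otimes X,\quad \varepsilon(X)=1,$$ $$\Delta(Y)=-\tfrac12\,(Y\otimes Y+XY\otimes Y+Y\otimes XY-XY\otimes XY),\quad \varepsilon(Y)=-1.$$ The reassociator, the distinguished elements $\alpha$ and $\beta$, and the antipode are respectively given by $$\Phi_X=1-2p^X_-\otimes p^X_-\otimes p^X_-,\quad \alpha=X,\quad \beta=1,\quad S(X)=X,\ S(Y)=Y,$$ where $p^X_-=\frac12(1-X)$. Moreover, $D(H(2))$ is an involutory quasi-Hopf algebra.
   Context: All algebras and linear spaces are over the field $k$; $\otimes=\otimes_k$. A quasi-bialgebra is a tuple $(H,\Delta,\varepsilon,\Phi)$ where $H$ is an associative unital algebra, $\Phi\in H\otimes H\otimes H$ (the reassociator) is invertible, and $\Delta:H\to H\otimes H$, $\varepsilon:H\to k$ are algebra homomorphisms such that, for all $h\in H$: $(\mathrm{id}\otimes\Delta)(\Delta(h))=\Phi(\Delta\otimes \mathrm{id})(\Delta(h))\Phi^{-1}$; $(\mathrm{id}\otimes\varepsilon)(\Delta(h))=h=(\varepsilon\otimes \mathrm{id})(\Delta(h))$; $(1\otimes\Phi)(\mathrm{id}\otimes\Delta\otimes \mathrm{id})(\Phi)(\Phi\otimes 1)=(\mathrm{id}\otimes \mathrm{id}\otimes\Delta)(\Phi)(\Delta\otimes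 \mathrm{id}\otimes \mathrm{id})(\Phi)$; $(\mathrm{id}\otimes\varepsilon\otimes \mathrm{id})(\Phi)=1\otimes 1$. Write $\Delta(h)=h_1\otimes h_2$, $(\Delta\otimes\mathrm{id})(\Delta(h))=h_{(1,1)}\otimes h_{(1,2)}\otimes h_2$, $\Phi=X^1\otimes X^2\otimes X^3=Y^1\otimes Y^2\otimes Y^3$, $\Phi^{-1}=x^1\otimes x^2\otimes x^3=y^1\otimes y^2\otimes y^3$ (summation understood; in these general formulas superscripts label tensor components, and different letters denote different copies). $H$ is a quasi-Hopf algebra if moreover there are an algebra anti-morphism $S:H\to H$ and $\alpha,\beta\in H$ with $S(h_1)\alpha h_2=\varepsilon(h)\alpha$, $h_1\beta S(h_2)=\varepsilon(h)\beta$, $X^1\beta S(X^2)\alpha X^3=1$, $S(x^1)\alpha x^2\beta S(x^3)=1$. It is involutory if $S^2(h)=S(\beta)\alpha h\beta S(\alpha)$ for all $h$. $H(2)$: the bialgebra $k[C_2]$, $C_2=\langle g\rangle$ of order two, with reassociator $\Phi=1-2p_-\otimes p_-\otimes p_-$, $p_-=\frac12(1-g)$, antipode $S=\mathrm{id}$, $\alpha=g$, $\beta=1$. Twist and related elements of a finite dimensional quasi-Hopf algebra $H$ (whose antipode is automatically bijective): $A^1\otimes A^2\otimes A^3\otimes A^4=(\Phi\otimes1)(\Delta\otimes\mathrm{id}\otimes\mathrm{id})(\Phi^{-1})$, $\gamma=S(A^2)\alpha A^3\otimes S(A^1)\alpha A^4$, $f=f^1\otimes f^2=(S\otimes S)(\Delta^{\rm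 cop}(x^1))\gamma\Delta(x^2\beta S(x^3))$ with $\Delta^{\rm cop}(h)=h_2\otimes h_1$; $f^{-1}=G^1\otimes G^2$; $p_R=p^1\otimes p^2=x^1\otimes x^2\beta S(x^3)$; $q_R=q^1\otimes q^2=X^1\otimes S^{-1}(\alpha X^3)X^2$; $U=U^1\otimes U^2=G^1S(q^2)\otimes G^2S(q^1)$. Quantum double: $H^*$ is a coalgebra with $\varphi\mapsto\varphi_1\otimes\varphi_2$, $\varphi(hh')=\varphi_1(h)\varphi_2(h')$; it has the convolution product $(\varphi\psi)(h)=\varphi(h_1)\psi(h_2)$ and is an $H$-bimodule by $(h\rightharpoonup\varphi)(h')=\varphi(h'h)$, $(\varphi\leftharpoonup h)(h')=\varphi(hh')$; $\overline S(\varphi)=\varphi\circ S$. Let $\Omega=\Omega^1\otimes\cdots\otimes\Omega^5=X^1_{(1,1)}y^1x^1\otimes X^1_{(1,2)}y^2x^2_1\otimes X^1_2y^3x^2_2\otimes S^{-1}(f^1X^2x^3)\otimes S^{-1}(f^2X^3)$. Then $D(H)=H^*\otimes H$ as a space, with elements written $\varphi\bowtie h$, multiplication $(\varphi\bowtie h)(\psi\bowtie h')=[(\Omega^1\rightharpoonup\varphi\leftharpoonup\Omega^5)(\Omega^2h_{(1,1)}\rightharpoonup\psi\leftharpoonup S^{-1}(h_2)\Omega^4)]\bowtie\Omega^3h_{(1,2)}h'$, unit $\varepsilon\bowtie1$, and quasi-Hopf structure $\Delta_D(\varphi\bowtie h)=(\varepsilon\bowtie X^1Y^1)(p^1_1x^1\rightharpoonup\varphi_2\leftharpoonup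 Y^2S^{-1}(p^2)\bowtie p^1_2x^2h_1)\otimes(X^2_1\rightharpoonup\varphi_1\leftharpoonup S^{-1}(X^3)\bowtie X^2_2Y^3x^3h_2)$, $\varepsilon_D(\varphi\bowtie h)=\varepsilon(h)\varphi(S^{-1}(\alpha))$, $\Phi_D=(i_D\otimes i_D\otimes i_D)(\Phi)$ with $i_D(h)=\varepsilon\bowtie h$, $S_D(\varphi\bowtie h)=(\varepsilon\bowtie S(h)f^1)(p^1_1U^1\rightharpoonup\overline S^{-1}(\varphi)\leftharpoonup f^2S^{-1}(p^2)\bowtie p^1_2U^2)$, $\alpha_D=\varepsilon\bowtie\alpha$, $\beta_D=\varepsilon\bowtie\beta$. *)

theory Defs
  imports
    "HOL-Analysis.Cartesian_Space"
    "HOL-Library.Poly_Mapping"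
    "HOL-Library.Z2"
begin

section \<open>Tensor products of finite dimensional spaces\<close>

text \<open>
  A finite dimensional space over \<open>k\<close> is represented as \<open>k ^ 'b\<close>, where the finite type \<open>'b\<close>
  indexes a basis; then \<open>k ^ 'b \<otimes> k ^ 'c = k ^ ('b \<times> 'c)\<close>. Iterated tensor products are nested
  to the right, so that \<open>\<otimes>\<close> associates to the right both on types and on elements.
\<close>

definition tensor :: "'k::field ^ 'b \<Rightarrow> 'k ^ 'c \<Rightarrow> 'k ^ ('b \<times> 'c)" (infixr \<open>\<otimes>\<close> 66)
  where "u \<otimes> v = (\<chi> ij. u $ fst ij * v $ snd ij)"

abbreviation basis_vec :: "'b \<Rightarrow> 'k::field ^ 'b"
  where "basis_vec i \<equiv> axis i 1"

text \<open>
  Sweedler notation. For a multilinear \<open>F\<close>, \<open>sw3 t (\<lambda>t1 t2 t3. F t1 t2 t3)\<close> is the value at \<open>t\<close> of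
  the linear map that \<open>F\<close> induces on the tensor product, i.e. what is written
  \<open>F(t\<^sup>1, t\<^sup>2, t\<^sup>3)\<close>, summation understood, for \<open>t = t\<^sup>1 \<otimes> t\<^sup>2 \<otimes> t\<^sup>3\<close>. It is computed by expanding
  \<open>t\<close> in the basis, and is only meant to be used with \<open>F\<close> multilinear.
\<close>

definition sw2 :: "'k::field ^ ('b::finite \<times> 'c::finite)
    \<Rightarrow> ('k ^ 'b \<Rightarrow> 'k ^ 'c \<Rightarrow> 'k ^ 'z) \<Rightarrow> 'k ^ 'z"
  where "sw2 t F = (\<Sum>(i, j)\<in>UNIV. t $ (i, j) *s F (basis_vec i) (basis_vec j))"

definition sw3 :: "'k::field ^ ('b::finite \<times> 'c::finite \<times> 'd::finite)
    \<Rightarrow> ('k ^ 'b \<Rightarrow> 'k ^ 'c \<Rightarrow> 'k ^ 'd \<Rightarrow> 'k ^ 'z) \<Rightarrow> 'k ^ 'z"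
  where "sw3 t F = (\<Sum>(i, j, l)\<in>UNIV.
    t $ (i, j, l) *s F (basis_vec i) (basis_vec j) (basis_vec l))"

definition sw4 :: "'k::field ^ ('b::finite \<times> 'c::finite \<times> 'd::finite \<times> 'e::finite)
    \<Rightarrow> ('k ^ 'b \<Rightarrow> 'k ^ 'c \<Rightarrow> 'k ^ 'd \<Rightarrow> 'k ^ 'e \<Rightarrow> 'k ^ 'z) \<Rightarrow> 'k ^ 'z"
  where "sw4 t F = (\<Sum>(i, j, l, m)\<in>UNIV.
    t $ (i, j, l, m) *s F (basis_vec i) (basis_vec j) (basis_vec l) (basis_vec m))"

definition sw5 :: "'k::field ^ ('b::finite \<times> 'c::finite \<times> 'd::finite \<times> 'e::finite \<times> 'f::finite)
    \<Rightarrow> ('k ^ 'b \<Rightarrow> 'k ^ 'c \<Rightarrow> 'k ^ 'd \<Rightarrow> 'k ^ 'e \<Rightarrow> 'k ^ 'f \<Rightarrow> 'k ^ 'z) \<Rightarrow> 'k ^ 'z"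
  where "sw5 t F = (\<Sum>(i, j, l, m, n)\<in>UNIV. t $ (i, j, l, m, n) *s
    F (basis_vec i) (basis_vec j) (basis_vec l) (basis_vec m) (basis_vec n))"


section \<open>Algebras\<close>

record ('k, 'b::finite) alg =
  mul :: "'k ^ 'b \<Rightarrow> 'k ^ 'b \<Rightarrow> 'k ^ 'b" (infixl \<open>\<cdot>\<index>\<close> 70)
  unit :: "'k ^ 'b" (\<open>\<one>\<index>\<close>)

abbreviation lin_map :: "('k::field ^ 'b \<Rightarrow> 'k ^ 'c) \<Rightarrow> bool"
  where "lin_map \<equiv> Vector_Spaces.linear (*s) (*s)"

abbreviation lin_form :: "('k::field ^ 'b \<Rightarrow> 'k) \<Rightarrow> bool"
  where "lin_form \<equiv> Vector_Spaces.linear (*s) (*)"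

definition unital_algebra :: "('k::field, 'b::finite, 'm) alg_scheme \<Rightarrow> bool"
  where "unital_algebra A \<longleftrightarrow>
    (\<forall>x. lin_map (\<lambda>y. x \<cdot> y) \<and> lin_map (\<lambda>y. y \<cdot> x)) \<and>
    (\<forall>x y z. (x \<cdot> y) \<cdot> z = x \<cdot> (y \<cdot> z)) \<and>
    (\<forall>x. \<one> \<cdot> x = x \<and> x \<cdot> \<one> = x)"
  for A (structure)

definition alg_unit :: "('k::field, 'b::finite, 'm) alg_scheme \<Rightarrow> 'k ^ 'b \<Rightarrow> bool"
  where "alg_unit A x \<longleftrightarrow> (\<exists>y. x \<cdot> y = \<one> \<and> y \<cdot> x = \<one>)"
  for A (structure)

definition alg_inv :: "('k::field, 'b::finite, 'm) alg_scheme \<Rightarrow> 'k ^ 'b \<Rightarrow> 'k ^ 'b"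
  where "alg_inv A x = (THE y. x \<cdot> y = \<one> \<and> y \<cdot> x = \<one>)"
  for A (structure)

definition tensor_alg :: "('k::field, 'b::finite, 'm) alg_scheme
    \<Rightarrow> ('k, 'c::finite, 'n) alg_scheme \<Rightarrow> ('k, 'b \<times> 'c) alg"
  where "tensor_alg A B =
    \<lparr> mul = (\<lambda>s t. sw2 s (\<lambda>a b. sw2 t (\<lambda>a' b'. (a \<cdot>\<^bsub>A\<^esub> a') \<otimes> (b \<cdot>\<^bsub>B\<^esub> b')))),
      unit = \<one>\<^bsub>A\<^esub> \<otimes> \<one>\<^bsub>B\<^esub> \<rparr>"

abbreviation T2 :: "('k::field, 'b::finite, 'm) alg_scheme \<Rightarrow> ('k, 'b \<times> 'b) alg"
  where "T2 A \<equiv> tensor_alg A A"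

abbreviation T3 :: "('k::field, 'b::finite, 'm) alg_scheme \<Rightarrow> ('k, 'b \<times> 'b \<times> 'b) alg"
  where "T3 A \<equiv> tensor_alg A (T2 A)"

abbreviation T4 :: "('k::field, 'b::finite, 'm) alg_scheme \<Rightarrow> ('k, 'b \<times> 'b \<times> 'b \<times> 'b) alg"
  where "T4 A \<equiv> tensor_alg A (T3 A)"

definition alg_hom :: "('k::field, 'b::finite, 'm) alg_scheme
    \<Rightarrow> ('k, 'c::finite, 'n) alg_scheme \<Rightarrow> ('k ^ 'b \<Rightarrow> 'k ^ 'c) \<Rightarrow> bool"
  where "alg_hom A B f \<longleftrightarrow> lin_map f \<and> (\<forall>x y. f (x \<cdot>\<^bsub>A\<^esub> y) = f x \<cdot>\<^bsub>B\<^esub> f y) \<and> f \<one>\<^bsub>A\<^esub> = \<one>\<^bsub>B\<^esub>"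

definition alg_antihom :: "('k::field, 'b::finite, 'm) alg_scheme
    \<Rightarrow> ('k, 'c::finite, 'n) alg_scheme \<Rightarrow> ('k ^ 'b \<Rightarrow> 'k ^ 'c) \<Rightarrow> bool"
  where "alg_antihom A B f \<longleftrightarrow> lin_map f \<and> (\<forall>x y. f (x \<cdot>\<^bsub>A\<^esub> y) = f y \<cdot>\<^bsub>B\<^esub> f x) \<and> f \<one>\<^bsub>A\<^esub> = \<one>\<^bsub>B\<^esub>"

definition alg_character :: "('k::field, 'b::finite, 'm) alg_scheme \<Rightarrow> ('k ^ 'b \<Rightarrow> 'k) \<Rightarrow> bool"
  where "alg_character A f \<longleftrightarrow> lin_form f \<and> (\<forall>x y. f (x \<cdot>\<^bsub>A\<^esub> y) = f x * f y) \<and> f \<one>\<^bsub>A\<^esub> = 1"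


section \<open>Presentations by generators and relations\<close>

datatype 'g free_monoid = Word (letters: "'g list")

instantiation free_monoid :: (type) monoid_add
begin

definition zero_free_monoid :: "'a free_monoid"
  where "0 = Word []"

definition plus_free_monoid :: "'a free_monoid \<Rightarrow> 'a free_monoid \<Rightarrow> 'a free_monoid"
  where "u + v = Word (letters u @ letters v)"

instance
  by standard (simp_all add: zero_free_monoid_def plus_free_monoid_def)

end

text \<open>
  The monoid algebra of the free monoid on \<open>'g\<close>, i.e. the free algebra \<open>k\<langle>'g\<rangle>\<close>; its ring
  structure is the convolution product on \<open>\<Rightarrow>\<^sub>0\<close>.
\<close>

type_synonym ('g, 'k) free_algebra = "'g free_monoid \<Rightarrow>\<^sub>0 'k"

definition gen :: "'g \<Rightarrow> ('g, 'k::field) free_algebra"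
  where "gen x = Poly_Mapping.single (Word [x]) 1"

definition two_sided_ideal :: "'r::ring_1 set \<Rightarrow> bool"
  where "two_sided_ideal I \<longleftrightarrow>
    0 \<in> I \<and> (\<forall>a\<in>I. \<forall>b\<in>I. a + b \<in> I) \<and> (\<forall>a\<in>I. \<forall>r. r * a \<in> I \<and> a * r \<in> I)"

definition ideal_generated :: "'r::ring_1 set \<Rightarrow> 'r set"
  where "ideal_generated R = \<Inter>{I. two_sided_ideal I \<and> R \<subseteq> I}"

definition word_eval :: "('k::field, 'b::finite, 'm) alg_scheme \<Rightarrow> ('g \<Rightarrow> 'k ^ 'b)
    \<Rightarrow> 'g free_monoid \<Rightarrow> 'k ^ 'b"
  where "word_eval A v w = foldr (\<lambda>x u. v x \<cdot> u) (letters w) \<one>"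
  for A (structure)

definition free_eval :: "('k::field, 'b::finite, 'm) alg_scheme \<Rightarrow> ('g \<Rightarrow> 'k ^ 'b)
    \<Rightarrow> ('g, 'k) free_algebra \<Rightarrow> 'k ^ 'b"
  where "free_eval A v p =
    (\<Sum>w\<in>Poly_Mapping.keys p. Poly_Mapping.lookup p w *s word_eval A v w)"

text \<open>
  \<open>A\<close> is the unital algebra generated by the elements \<open>v x\<close> with relations \<open>R\<close>: the canonical
  homomorphism \<open>k\<langle>'g\<rangle> \<rightarrow> A\<close> induces an isomorphism \<open>k\<langle>'g\<rangle> / (R) \<cong> A\<close>.
\<close>

definition presented_by :: "('k::field, 'b::finite, 'm) alg_scheme \<Rightarrow> ('g \<Rightarrow> 'k ^ 'b)
    \<Rightarrow> ('g, 'k) free_algebra set \<Rightarrow> bool"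
  where "presented_by A v R \<longleftrightarrow>
    unital_algebra A \<and> surj (free_eval A v) \<and> {p. free_eval A v p = 0} = ideal_generated R"


section \<open>Quasi-bialgebras and quasi-Hopf algebras\<close>

record ('k, 'b::finite) quasi_bialg = "('k, 'b) alg" +
  comult :: "'k ^ 'b \<Rightarrow> 'k ^ ('b \<times> 'b)" (\<open>\<Delta>\<index>\<close>)
  counit :: "'k ^ 'b \<Rightarrow> 'k" (\<open>\<epsilon>\<index>\<close>)
  reassoc :: "'k ^ ('b \<times> 'b \<times> 'b)" (\<open>\<Phi>\<index>\<close>)

record ('k, 'b::finite) quasi_hopf = "('k, 'b) quasi_bialg" +
  antipode :: "'k ^ 'b \<Rightarrow> 'k ^ 'b" (\<open>\<S>\<index>\<close>)
  alpha :: "'k ^ 'b" (\<open>\<alpha>\<index>\<close>)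
  beta :: "'k ^ 'b" (\<open>\<beta>\<index>\<close>)

definition reassoc_inv :: "('k::field, 'b::finite, 'm) quasi_bialg_scheme
    \<Rightarrow> 'k ^ ('b \<times> 'b \<times> 'b)" (\<open>\<Phi>inv\<index>\<close>)
  where "reassoc_inv H = alg_inv (T3 H) (reassoc H)"

definition is_quasi_bialgebra :: "('k::field, 'b::finite, 'm) quasi_bialg_scheme \<Rightarrow> bool"
  where "is_quasi_bialgebra H \<longleftrightarrow>
    unital_algebra H \<and>
    alg_unit (T3 H) \<Phi> \<and>
    alg_hom H (T2 H) \<Delta> \<and>
    alg_character H \<epsilon> \<and>
    (\<forall>h. sw2 (\<Delta> h) (\<lambda>h1 h2. h1 \<otimes> \<Delta> h2) =
      \<Phi> \<cdot>\<^bsub>T3 H\<^esub> sw2 (\<Delta> h) (\<lambda>h1 h2. sw2 (\<Delta> h1) (\<lambda>h11 h12. h11 \<otimes> h12 \<otimes> h2)) \<cdot>\<^bsub>T3 H\<^esub> \<Phi>inv) \<and>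
    (\<forall>h. sw2 (\<Delta> h) (\<lambda>h1 h2. \<epsilon> h2 *s h1) = h \<and> sw2 (\<Delta> h) (\<lambda>h1 h2. \<epsilon> h1 *s h2) = h) \<and>
    (\<one> \<otimes> \<Phi>)
      \<cdot>\<^bsub>T4 H\<^esub> sw3 \<Phi> (\<lambda>X1 X2 X3. sw2 (\<Delta> X2) (\<lambda>X21 X22. X1 \<otimes> X21 \<otimes> X22 \<otimes> X3))
      \<cdot>\<^bsub>T4 H\<^esub> sw3 \<Phi> (\<lambda>X1 X2 X3. X1 \<otimes> X2 \<otimes> X3 \<otimes> \<one>)
    = sw3 \<Phi> (\<lambda>X1 X2 X3. X1 \<otimes> X2 \<otimes> \<Delta> X3)
      \<cdot>\<^bsub>T4 H\<^esub> sw3 \<Phi> (\<lambda>X1 X2 X3. sw2 (\<Delta> X1) (\<lambda>X11 X12. X11 \<otimes> X12 \<otimes> X2 \<otimes> X3)) \<and>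
    sw3 \<Phi> (\<lambda>X1 X2 X3. \<epsilon> X2 *s (X1 \<otimes> X3)) = \<one> \<otimes> \<one>"
  for H (structure)

definition is_quasi_hopf_algebra :: "('k::field, 'b::finite, 'm) quasi_hopf_scheme \<Rightarrow> bool"
  where "is_quasi_hopf_algebra H \<longleftrightarrow>
    is_quasi_bialgebra H \<and>
    alg_antihom H H \<S> \<and>
    (\<forall>h. sw2 (\<Delta> h) (\<lambda>h1 h2. \<S> h1 \<cdot> \<alpha> \<cdot> h2) = \<epsilon> h *s \<alpha>) \<and>
    (\<forall>h. sw2 (\<Delta> h) (\<lambda>h1 h2. h1 \<cdot> \<beta> \<cdot> \<S> h2) = \<epsilon> h *s \<beta>) \<and>
    sw3 \<Phi> (\<lambda>X1 X2 X3. X1 \<cdot> \<beta> \<cdot> \<S> X2 \<cdot> \<alpha> \<cdot> X3) = \<one> \<and>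
    sw3 \<Phi>inv (\<lambda>x1 x2 x3. \<S> x1 \<cdot> \<alpha> \<cdot> x2 \<cdot> \<beta> \<cdot> \<S> x3) = \<one>"
  for H (structure)

definition is_involutory :: "('k::field, 'b::finite, 'm) quasi_hopf_scheme \<Rightarrow> bool"
  where "is_involutory H \<longleftrightarrow> (\<forall>h. \<S> (\<S> h) = \<S> \<beta> \<cdot> \<alpha> \<cdot> h \<cdot> \<beta> \<cdot> \<S> \<alpha>)"
  for H (structure)


section \<open>The twist and related elements\<close>

definition antipode_inv :: "('k::field, 'b::finite, 'm) quasi_hopf_scheme
    \<Rightarrow> 'k ^ 'b \<Rightarrow> 'k ^ 'b" (\<open>\<S>inv\<index>\<close>)
  where "antipode_inv H = inv (antipode H)"

definition A_elem :: "('k::field, 'b::finite, 'm) quasi_hopf_scheme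
    \<Rightarrow> 'k ^ ('b \<times> 'b \<times> 'b \<times> 'b)"
  where "A_elem H =
    sw3 \<Phi> (\<lambda>X1 X2 X3. X1 \<otimes> X2 \<otimes> X3 \<otimes> \<one>)
    \<cdot>\<^bsub>T4 H\<^esub> sw3 \<Phi>inv (\<lambda>x1 x2 x3. sw2 (\<Delta> x1) (\<lambda>x11 x12. x11 \<otimes> x12 \<otimes> x2 \<otimes> x3))"
  for H (structure)

definition gamma_elem :: "('k::field, 'b::finite, 'm) quasi_hopf_scheme \<Rightarrow> 'k ^ ('b \<times> 'b)"
  where "gamma_elem H =
    sw4 (A_elem H) (\<lambda>A1 A2 A3 A4. (\<S> A2 \<cdot> \<alpha> \<cdot> A3) \<otimes> (\<S> A1 \<cdot> \<alpha> \<cdot> A4))"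
  for H (structure)

definition f_elem :: "('k::field, 'b::finite, 'm) quasi_hopf_scheme \<Rightarrow> 'k ^ ('b \<times> 'b)"
  where "f_elem H =
    sw3 \<Phi>inv (\<lambda>x1 x2 x3.
      sw2 (\<Delta> x1) (\<lambda>x11 x12. \<S> x12 \<otimes> \<S> x11) \<cdot>\<^bsub>T2 H\<^esub> gamma_elem H \<cdot>\<^bsub>T2 H\<^esub> \<Delta> (x2 \<cdot> \<beta> \<cdot> \<S> x3))"
  for H (structure)

definition f_inv :: "('k::field, 'b::finite, 'm) quasi_hopf_scheme \<Rightarrow> 'k ^ ('b \<times> 'b)"
  where "f_inv H = alg_inv (T2 H) (f_elem H)"

definition p_R :: "('k::field, 'b::finite, 'm) quasi_hopf_scheme \<Rightarrow> 'k ^ ('b \<times> 'b)"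
  where "p_R H = sw3 \<Phi>inv (\<lambda>x1 x2 x3. x1 \<otimes> (x2 \<cdot> \<beta> \<cdot> \<S> x3))"
  for H (structure)

definition q_R :: "('k::field, 'b::finite, 'm) quasi_hopf_scheme \<Rightarrow> 'k ^ ('b \<times> 'b)"
  where "q_R H = sw3 \<Phi> (\<lambda>X1 X2 X3. X1 \<otimes> (\<S>inv (\<alpha> \<cdot> X3) \<cdot> X2))"
  for H (structure)

definition U_elem :: "('k::field, 'b::finite, 'm) quasi_hopf_scheme \<Rightarrow> 'k ^ ('b \<times> 'b)"
  where "U_elem H =
    sw2 (f_inv H) (\<lambda>G1 G2. sw2 (q_R H) (\<lambda>q1 q2. (G1 \<cdot> \<S> q2) \<otimes> (G2 \<cdot> \<S> q1)))"
  for H (structure)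


section \<open>The dual space\<close>

text \<open>
  A functional on \<open>k ^ 'b\<close> is represented by its coordinates in the dual basis, so that the dual
  of \<open>k ^ 'b\<close> is again \<open>k ^ 'b\<close>: \<open>eval_dual\<close> applies such a functional to a vector, and \<open>dual_of\<close>
  yields the representation of a linear form.
\<close>

abbreviation eval_dual :: "'k::field ^ 'b::finite \<Rightarrow> 'k ^ 'b \<Rightarrow> 'k"
  where "eval_dual \<equiv> scalar_product"

definition dual_of :: "('k::field ^ 'b::finite \<Rightarrow> 'k) \<Rightarrow> 'k ^ 'b"
  where "dual_of F = (\<chi> i. F (basis_vec i))"

definition act_left :: "('k::field, 'b::finite, 'm) alg_scheme
    \<Rightarrow> 'k ^ 'b \<Rightarrow> 'k ^ 'b \<Rightarrow> 'k ^ 'b" (infixr \<open>\<rightharpoonup>\<index>\<close> 68)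
  where "act_left H h \<phi> = dual_of (\<lambda>h'. eval_dual \<phi> (h' \<cdot> h))"
  for H (structure)

definition act_right :: "('k::field, 'b::finite, 'm) alg_scheme
    \<Rightarrow> 'k ^ 'b \<Rightarrow> 'k ^ 'b \<Rightarrow> 'k ^ 'b" (infixl \<open>\<leftharpoonup>\<index>\<close> 69)
  where "act_right H \<phi> h = dual_of (\<lambda>h'. eval_dual \<phi> (h \<cdot> h'))"
  for H (structure)

text \<open>
  The convolution product and the coproduct of the dual, via the identification of the dual of
  \<open>k ^ 'b \<otimes> k ^ 'b\<close> with the tensor square of the dual.
\<close>

definition conv :: "('k::field, 'b::finite, 'm) quasi_bialg_scheme
    \<Rightarrow> 'k ^ 'b \<Rightarrow> 'k ^ 'b \<Rightarrow> 'k ^ 'b" (infixl \<open>\<star>\<index>\<close> 67)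
  where "conv H \<phi> \<psi> = dual_of (\<lambda>h. eval_dual (\<phi> \<otimes> \<psi>) (\<Delta> h))"
  for H (structure)

definition dual_comult :: "('k::field, 'b::finite, 'm) alg_scheme
    \<Rightarrow> 'k ^ 'b \<Rightarrow> 'k ^ ('b \<times> 'b)"
  where "dual_comult H \<phi> = dual_of (\<lambda>t. eval_dual \<phi> (sw2 t (\<lambda>h h'. h \<cdot> h')))"
  for H (structure)

definition counit_dual :: "('k::field, 'b::finite, 'm) quasi_bialg_scheme \<Rightarrow> 'k ^ 'b"
  where "counit_dual H = dual_of (counit H)"

definition dual_antipode :: "('k::field, 'b::finite, 'm) quasi_hopf_scheme
    \<Rightarrow> 'k ^ 'b \<Rightarrow> 'k ^ 'b"
  where "dual_antipode H \<phi> = dual_of (\<lambda>h. eval_dual \<phi> (\<S> h))"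
  for H (structure)


section \<open>The quantum double\<close>

abbreviation (input) bowtie :: "'k::field ^ 'b \<Rightarrow> 'k ^ 'b \<Rightarrow> 'k ^ ('b \<times> 'b)" (infix \<open>\<bowtie>\<close> 66)
  where "\<phi> \<bowtie> h \<equiv> \<phi> \<otimes> h"

definition Omega :: "('k::field, 'b::finite, 'm) quasi_hopf_scheme
    \<Rightarrow> 'k ^ ('b \<times> 'b \<times> 'b \<times> 'b \<times> 'b)"
  where "Omega H =
    sw3 \<Phi> (\<lambda>X1 X2 X3. sw3 \<Phi>inv (\<lambda>x1 x2 x3. sw3 \<Phi>inv (\<lambda>y1 y2 y3. sw2 (f_elem H) (\<lambda>f1 f2.
    sw2 (\<Delta> X1) (\<lambda>X1_1 X1_2. sw2 (\<Delta> X1_1) (\<lambda>X1_11 X1_12. sw2 (\<Delta> x2) (\<lambda>x2_1 x2_2.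
      (X1_11 \<cdot> y1 \<cdot> x1) \<otimes> (X1_12 \<cdot> y2 \<cdot> x2_1) \<otimes> (X1_2 \<cdot> y3 \<cdot> x2_2)
        \<otimes> \<S>inv (f1 \<cdot> X2 \<cdot> x3) \<otimes> \<S>inv (f2 \<cdot> X3))))))))"
  for H (structure)

definition double_alg :: "('k::field, 'b::finite, 'm) quasi_hopf_scheme \<Rightarrow> ('k, 'b \<times> 'b) alg"
  where "double_alg H =
    \<lparr> mul = (\<lambda>u v. sw2 u (\<lambda>\<phi> h. sw2 v (\<lambda>\<psi> h'.
        sw5 (Omega H) (\<lambda>O1 O2 O3 O4 O5. sw2 (\<Delta> h) (\<lambda>h1 h2. sw2 (\<Delta> h1) (\<lambda>h11 h12.
          ((O1 \<rightharpoonup> \<phi> \<leftharpoonup> O5) \<star> (O2 \<cdot> h11 \<rightharpoonup> \<psi> \<leftharpoonup> \<S>inv h2 \<cdot> O4)) \<bowtie> (O3 \<cdot> h12 \<cdot> h'))))))),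
      unit = counit_dual H \<bowtie> \<one> \<rparr>"
  for H (structure)

definition i_D :: "('k::field, 'b::finite, 'm) quasi_hopf_scheme \<Rightarrow> 'k ^ 'b \<Rightarrow> 'k ^ ('b \<times> 'b)"
  where "i_D H h = counit_dual H \<bowtie> h"

definition double_comult :: "('k::field, 'b::finite, 'm) quasi_hopf_scheme
    \<Rightarrow> 'k ^ ('b \<times> 'b) \<Rightarrow> 'k ^ (('b \<times> 'b) \<times> ('b \<times> 'b))"
  where "double_comult H u = sw2 u (\<lambda>\<phi> h.
    sw3 \<Phi> (\<lambda>X1 X2 X3. sw3 \<Phi> (\<lambda>Y1 Y2 Y3. sw3 \<Phi>inv (\<lambda>x1 x2 x3. sw2 (p_R H) (\<lambda>p1 p2.
    sw2 (\<Delta> p1) (\<lambda>p1_1 p1_2. sw2 (\<Delta> X2) (\<lambda>X2_1 X2_2. sw2 (\<Delta> h) (\<lambda>h1 h2.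
    sw2 (dual_comult H \<phi>) (\<lambda>\<phi>1 \<phi>2.
      (i_D H (X1 \<cdot> Y1) \<cdot>\<^bsub>double_alg H\<^esub>
        ((p1_1 \<cdot> x1 \<rightharpoonup> \<phi>2 \<leftharpoonup> Y2 \<cdot> \<S>inv p2) \<bowtie> (p1_2 \<cdot> x2 \<cdot> h1)))
      \<otimes> ((X2_1 \<rightharpoonup> \<phi>1 \<leftharpoonup> \<S>inv X3) \<bowtie> (X2_2 \<cdot> Y3 \<cdot> x3 \<cdot> h2)))))))))))"
  for H (structure)

text \<open>
  \<open>\<phi> \<bowtie> h \<mapsto> \<epsilon>(h) \<phi>(S\<^sup>-\<^sup>1(\<alpha>))\<close>: a scalar valued bilinear map, hence evaluated with the pairing.
\<close>

definition double_counit :: "('k::field, 'b::finite, 'm) quasi_hopf_scheme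
    \<Rightarrow> 'k ^ ('b \<times> 'b) \<Rightarrow> 'k"
  where "double_counit H u = eval_dual u (\<S>inv \<alpha> \<otimes> counit_dual H)"
  for H (structure)

definition double_antipode :: "('k::field, 'b::finite, 'm) quasi_hopf_scheme
    \<Rightarrow> 'k ^ ('b \<times> 'b) \<Rightarrow> 'k ^ ('b \<times> 'b)"
  where "double_antipode H u = sw2 u (\<lambda>\<phi> h.
    sw2 (f_elem H) (\<lambda>f1 f2. sw2 (p_R H) (\<lambda>p1 p2. sw2 (\<Delta> p1) (\<lambda>p1_1 p1_2. sw2 (U_elem H) (\<lambda>U1 U2.
      i_D H (\<S> h \<cdot> f1) \<cdot>\<^bsub>double_alg H\<^esub>
        ((p1_1 \<cdot> U1 \<rightharpoonup> inv (dual_antipode H) \<phi> \<leftharpoonup> f2 \<cdot> \<S>inv p2) \<bowtie> (p1_2 \<cdot> U2)))))))"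
  for H (structure)

definition quantum_double :: "('k::field, 'b::finite, 'm) quasi_hopf_scheme
    \<Rightarrow> ('k, 'b \<times> 'b) quasi_hopf"
  where "quantum_double H =
    \<lparr> mul = mul (double_alg H),
      unit = unit (double_alg H),
      comult = double_comult H,
      counit = double_counit H,
      reassoc = sw3 \<Phi> (\<lambda>X1 X2 X3. i_D H X1 \<otimes> i_D H X2 \<otimes> i_D H X3),
      antipode = double_antipode H,
      alpha = i_D H \<alpha>,
      beta = i_D H \<beta> \<rparr>"
  for H (structure)


section \<open>The quasi-Hopf algebra \<open>H(2)\<close>\<close>

instance bit :: finite
proof
  have "(UNIV :: bit set) = {0, 1}"
    by (auto intro: bit.exhaust)
  then show "finite (UNIV :: bit set)"
    by (metis finite.emptyI finite.insertI)
qed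

definition group_alg :: "('k::field, 'g::{finite, group_add}) alg"
  where "group_alg =
    \<lparr> mul = (\<lambda>u v. \<Sum>a\<in>UNIV. \<Sum>b\<in>UNIV. (u $ a * v $ b) *s basis_vec (a + b)),
      unit = basis_vec 0 \<rparr>"

text \<open>
  The group \<open>C\<^sub>2\<close> is the additive group of the type \<open>bit\<close>, with generator \<open>g = 1\<close>;
  \<open>k[C\<^sub>2]\<close> has the basis of group elements, on which \<open>\<Delta>(a) = a \<otimes> a\<close> and \<open>\<epsilon>(a) = 1\<close>.
\<close>

definition g_elem :: "'k::field ^ bit"
  where "g_elem = basis_vec 1"

definition p_minus :: "('k::field, 'b::finite, 'm) alg_scheme \<Rightarrow> 'k ^ 'b \<Rightarrow> 'k ^ 'b"
  where "p_minus A x = (1 / 2) *s (\<one> - x)"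
  for A (structure)

definition H2 :: "('k::field, bit) quasi_hopf"
  where "H2 =
    \<lparr> mul = mul group_alg,
      unit = unit group_alg,
      comult = (\<lambda>u. \<Sum>a\<in>UNIV. u $ a *s (basis_vec a \<otimes> basis_vec a)),
      counit = (\<lambda>u. \<Sum>a\<in>UNIV. u $ a),
      reassoc =
        (let p = p_minus group_alg g_elem
         in unit (T3 group_alg) - 2 *s (p \<otimes> p \<otimes> p)),
      antipode = id,
      alpha = g_elem,
      beta = unit group_alg \<rparr>"

datatype generator = GX | GY

end

theory Submission
  imports Defs
begin

text \<open>Let \<open>p = p\<^sub>-\<close>, let \<open>\<epsilon>, \<chi>\<close> be the two characters of \<open>C\<^sub>2\<close>, which form a basis of the dual of \<open>H(2)\<close>,
  and note \<open>h \<rightharpoonup> \<psi> = \<psi>(h) \<psi> = \<psi> \<leftharpoonup> h\<close> for a character \<open>\<psi>\<close>. On the idempotents \<open>1 - p, p\<close> the reassociator is the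
  sign cocycle \<open>(-1)\<^bsup>ijk\<^esup>\<close>, so \<open>f = f\<^sup>-\<^sup>1 = p\<^sub>R = 1 - 2 p \<otimes> p\<close>, \<open>U = g \<otimes> 1\<close>, and \<open>\<Omega>\<close> is again a sign. In the
  basis \<open>1, P = \<epsilon> \<bowtie> p, Y = \<chi> \<bowtie> 1, PY = \<chi> \<bowtie> p\<close> of the double one reads off \<open>P\<^sup>2 = P\<close>, \<open>Y\<^sup>2 = 1 - 2P = X\<close>,
  \<open>\<Delta>(Y) = - (Y \<otimes> Y) (1 - 2 P \<otimes> P)\<close>, \<open>S = id\<close>. All axioms are multilinear and are checked on this basis.
  Modulo the relations every word in \<open>X, Y\<close> is one of \<open>1, Y, Y\<^sup>2, Y\<^sup>3\<close>, and these four powers form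
  a basis of the double, which gives the presentation.\<close>

section \<open>Linear maps and tensors\<close>

lemma lin_map_iff: "lin_map f \<longleftrightarrow> (\<forall>x y. f (x + y) = f x + f y) \<and> (\<forall>c x. f (c *s x) = c *s f x)"
  unfolding Vector_Spaces.linear_iff
  by (auto intro: vector_space.intro vec.vector_space_axioms)

lemma lin_form_iff: "lin_form f \<longleftrightarrow> (\<forall>x y. f (x + y) = f x + f y) \<and> (\<forall>c x. f (c *s x) = c * f x)"
  unfolding Vector_Spaces.linear_iff
  using vec.vector_space_axioms vector_space_over_itself.vector_space_axioms by blast

lemma lin_map_add: "lin_map f \<Longrightarrow> f (x + y) = f x + f y"
  and lin_map_scale: "lin_map f \<Longrightarrow> f (c *s x) = c *s f x"
  by (simp_all add: lin_map_iff)

lemma lin_map_sum: "lin_map f \<Longrightarrow> f (\<Sum>i\<in>I. g i) = (\<Sum>i\<in>I. f (g i))"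
  unfolding Vector_Spaces.linear_def using module_hom.sum by blast

lemma vec_as_sum: "(u :: 'k::field ^ 'b::finite) = (\<Sum>i\<in>UNIV. u $ i *s basis_vec i)"
  by (rule basis_expansion[symmetric])

lemma lin_map_expand:
  assumes "lin_map f" shows "f u = (\<Sum>i\<in>UNIV. u $ i *s f (basis_vec i))"
  by (subst vec_as_sum[of u]) (simp add: lin_map_sum[OF assms] lin_map_scale[OF assms])

lemma sum_UNIV_prod: "(\<Sum>ij\<in>UNIV. h ij) = (\<Sum>i\<in>UNIV. \<Sum>j\<in>UNIV. h (i, j))"
  by (simp add: sum.cartesian_product flip: UNIV_Times_UNIV)

text \<open>The expansion of \<open>u\<close> is collapsed while the second slot still holds a basis
  vector, so linearity in the first slot is assumed for every \<open>b\<close>; the second slot is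
  then collapsed only at the fixed \<open>u\<close>.\<close>

lemma sw2_tensor:
  assumes "\<And>b. lin_map (\<lambda>a. F a b)" and "lin_map (F u)"
  shows "sw2 (u \<otimes> v) F = F u v"
proof -
  have "sw2 (u \<otimes> v) F = (\<Sum>j\<in>UNIV. v $ j *s (\<Sum>i\<in>UNIV. u $ i *s F (basis_vec i) (basis_vec j)))"
    unfolding sw2_def sum_UNIV_prod
    by (subst sum.swap) (simp add: tensor_def vec.scale_sum_right mult.commute)
  also have "\<dots> = F u v"
    by (simp add: lin_map_expand[OF assms(2), of v] flip: lin_map_expand[OF assms(1), of u])
  finally show ?thesis .
qed

text \<open>Only the first slot is peeled off; iterating down to \<open>sw2_tensor\<close> evaluates
  longer pure tensors slot by slot.\<close>

lemma sw3_tensor: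
  assumes "\<And>b c. lin_map (\<lambda>a. F a b c)"
  shows "sw3 (u \<otimes> v) F = sw2 v (F u)"
  unfolding sw3_def sw2_def split_def
  by (subst sum_UNIV_prod, subst sum.swap)
    (simp add: tensor_def lin_map_expand[OF assms, of u] vec.scale_sum_right mult.commute)

lemma sw4_tensor:
  assumes "\<And>b c d. lin_map (\<lambda>a. F a b c d)"
  shows "sw4 (u \<otimes> v) F = sw3 v (F u)"
  unfolding sw4_def sw3_def split_def
  by (subst sum_UNIV_prod, subst sum.swap)
    (simp add: tensor_def lin_map_expand[OF assms, of u] vec.scale_sum_right mult.commute)

lemma sw5_tensor:
  assumes "\<And>b c d e. lin_map (\<lambda>a. F a b c d e)"
  shows "sw5 (u \<otimes> v) F = sw4 v (F u)"
  unfolding sw5_def sw4_def split_def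
  by (subst sum_UNIV_prod, subst sum.swap)
    (simp add: tensor_def lin_map_expand[OF assms, of u] vec.scale_sum_right mult.commute)

text \<open>
  With these weak congruences the simplifier evaluates nested Sweedler expressions from the outside
  inwards, so that the linearity conditions of \<open>sw2_tensor\<close> etc. are met on unexpanded bodies.
\<close>

lemma sw2_cong_weak: "t = t' \<Longrightarrow> sw2 t F = sw2 t' F" by simp
lemma sw3_cong_weak: "t = t' \<Longrightarrow> sw3 t F = sw3 t' F" by simp
lemma sw4_cong_weak: "t = t' \<Longrightarrow> sw4 t F = sw4 t' F" by simp
lemma sw5_cong_weak: "t = t' \<Longrightarrow> sw5 t F = sw5 t' F" by simp

lemmas sw_congs = sw2_cong_weak sw3_cong_weak sw4_cong_weak sw5_cong_weak

lemma lin_map_sumI: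
  "(\<And>i. i \<in> I \<Longrightarrow> lin_map (\<lambda>t. f i t)) \<Longrightarrow> lin_map (\<lambda>t. \<Sum>i\<in>I. f i t)"
  by (simp add: lin_map_iff sum.distrib vec.scale_sum_right)

lemma lin_map_const_scale: "lin_map f \<Longrightarrow> lin_map (\<lambda>x. c *s f x)"
  by (simp add: lin_map_iff vec.scale_right_distrib vec.scale_left_commute)

lemma lin_map_sw: "lin_map (\<lambda>t. sw2 t F2)" "lin_map (\<lambda>t. sw3 t F3)"
    "lin_map (\<lambda>t. sw4 t F4)" "lin_map (\<lambda>t. sw5 t F5)"
  unfolding sw2_def sw3_def sw4_def sw5_def split_def
  by (rule lin_map_sumI, simp add: lin_map_iff vec.scale_left_distrib)+

lemma lin_map_comp: "lin_map g \<Longrightarrow> lin_map f \<Longrightarrow> lin_map (\<lambda>x. g (f x))"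
  by (simp add: lin_map_iff)

lemma lin_map_minus: "lin_map f \<Longrightarrow> f (- x) = - f x"
  using lin_map_scale[of f "- 1" x] by simp

lemma lin_map_diff: "lin_map f \<Longrightarrow> f (x - y) = f x - f y"
  using lin_map_add[of f x "- y"] lin_map_minus[of f y] by simp

lemma lin_map_zero: "lin_map f \<Longrightarrow> f 0 = 0"
  using lin_map_scale[of f 0 0] by simp

lemmas lin_map_distribs = lin_map_add lin_map_diff lin_map_minus lin_map_scale lin_map_zero

lemmas sw_distribs = lin_map_sw[THEN lin_map_add] lin_map_sw[THEN lin_map_diff]
  lin_map_sw[THEN lin_map_minus] lin_map_sw[THEN lin_map_scale] lin_map_sw[THEN lin_map_zero]

lemma lin_map_id: "lin_map (\<lambda>x. x)"
  by (simp add: lin_map_iff)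

lemma lin_map_tensor_const: "lin_map (\<lambda>u. u \<otimes> c)" and lin_map_const_tensor: "lin_map (\<lambda>u. c \<otimes> u)"
  by (simp_all add: lin_map_iff tensor_def vec_eq_iff algebra_simps)

lemmas tensor_distribs =
  lin_map_tensor_const[THEN lin_map_add] lin_map_tensor_const[THEN lin_map_diff]
  lin_map_tensor_const[THEN lin_map_minus] lin_map_tensor_const[THEN lin_map_scale]
  lin_map_tensor_const[THEN lin_map_zero]
  lin_map_const_tensor[THEN lin_map_add] lin_map_const_tensor[THEN lin_map_diff]
  lin_map_const_tensor[THEN lin_map_minus] lin_map_const_tensor[THEN lin_map_scale]
  lin_map_const_tensor[THEN lin_map_zero]

lemma lin_map_sw_body:
  "(\<And>a b. lin_map (\<lambda>x. F2 x a b)) \<Longrightarrow> lin_map (\<lambda>x. sw2 t2 (F2 x))"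
  "(\<And>a b c. lin_map (\<lambda>x. F3 x a b c)) \<Longrightarrow> lin_map (\<lambda>x. sw3 t3 (F3 x))"
  "(\<And>a b c d. lin_map (\<lambda>x. F4 x a b c d)) \<Longrightarrow> lin_map (\<lambda>x. sw4 t4 (F4 x))"
  "(\<And>a b c d e. lin_map (\<lambda>x. F5 x a b c d e)) \<Longrightarrow> lin_map (\<lambda>x. sw5 t5 (F5 x))"
  unfolding sw2_def sw3_def sw4_def sw5_def split_def
  by (auto intro!: lin_map_sumI lin_map_const_scale)

lemma lin_map_scale_form: "lin_form f \<Longrightarrow> lin_map (\<lambda>x. f x *s c)"
  by (simp add: lin_map_iff lin_form_iff vec.scale_left_distrib)

lemma lin_map_plus: "lin_map f \<Longrightarrow> lin_map g \<Longrightarrow> lin_map (\<lambda>x. f x + g x)"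
  and lin_map_subtract: "lin_map f \<Longrightarrow> lin_map g \<Longrightarrow> lin_map (\<lambda>x. f x - g x)"
  by (simp_all add: lin_map_iff vec.scale_right_distrib vec.scale_right_diff_distrib)

lemmas lin_intros = lin_map_id lin_map_sw[THEN lin_map_comp] lin_map_sw_body
  lin_map_tensor_const[THEN lin_map_comp] lin_map_const_tensor[THEN lin_map_comp]
  lin_map_scale_form lin_map_const_scale

section \<open>Unital algebras and their tensor products\<close>

lemma
  assumes "unital_algebra A"
  shows unital_algebra_lin: "lin_map (\<lambda>y. mul A x y)" "lin_map (\<lambda>y. mul A y x)"
    and unital_algebra_assoc: "mul A (mul A x y) z = mul A x (mul A y z)"
    and unital_algebra_unit: "mul A (unit A) x = x" "mul A x (unit A) = x"
  using assms by (auto simp: unital_algebra_def)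

lemmas lin_mul = unital_algebra_lin[THEN lin_map_comp]

lemmas mul_distribs =
  unital_algebra_lin[THEN lin_map_add] unital_algebra_lin[THEN lin_map_diff]
  unital_algebra_lin[THEN lin_map_minus] unital_algebra_lin[THEN lin_map_scale]
  unital_algebra_lin[THEN lin_map_zero]

lemma mul_tensor_alg_sw: "s \<cdot>\<^bsub>tensor_alg A B\<^esub> t =
    sw2 s (\<lambda>a b. sw2 t (\<lambda>a' b'. (a \<cdot>\<^bsub>A\<^esub> a') \<otimes> (b \<cdot>\<^bsub>B\<^esub> b')))"
  by (simp add: tensor_alg_def)

lemma mul_tensor_alg:
  assumes "unital_algebra A" "unital_algebra B"
  shows "(a \<otimes> b) \<cdot>\<^bsub>tensor_alg A B\<^esub> (a' \<otimes> b') = (a \<cdot>\<^bsub>A\<^esub> a') \<otimes> (b \<cdot>\<^bsub>B\<^esub> b')"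
  unfolding mul_tensor_alg_sw by (simp add: sw2_tensor assms lin_intros lin_mul cong: sw_congs)

lemma unit_tensor_alg: "\<one>\<^bsub>tensor_alg A B\<^esub> = \<one>\<^bsub>A\<^esub> \<otimes> \<one>\<^bsub>B\<^esub>"
  by (simp add: tensor_alg_def)

lemma lin_map_eqI:
  assumes "lin_map f" "lin_map g" "\<And>i. f (basis_vec i) = g (basis_vec i)"
  shows "f u = g u"
  by (subst lin_map_expand[OF assms(1)], subst lin_map_expand[OF assms(2)]) (simp add: assms(3))

lemma basis_vec_tensor: "basis_vec (i, j) = basis_vec i \<otimes> basis_vec j"
  by (auto simp: vec_eq_iff tensor_def axis_def)

lemma lin_map_tensor_eqI:
  assumes "lin_map f" "lin_map g" "\<And>a b. f (a \<otimes> b) = g (a \<otimes> b)"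
  shows "f u = g u"
  by (rule lin_map_eqI) (auto simp: assms basis_vec_tensor)

lemma unital_algebra_tensor_alg:
  assumes A: "unital_algebra A" and B: "unital_algebra B"
  shows "unital_algebra (tensor_alg A B)"
proof -
  let ?m = "mul (tensor_alg A B)"
  have l1: "lin_map (\<lambda>y. ?m x y)" for x
    unfolding mul_tensor_alg_sw by (simp add: lin_intros cong: sw_congs)
  have l2: "lin_map (\<lambda>y. ?m y x)" for x
    unfolding mul_tensor_alg_sw by (simp add: lin_intros cong: sw_congs)
  note lm = lin_intros l1[THEN lin_map_comp] l2[THEN lin_map_comp]
  note t = mul_tensor_alg[OF A B]
  \<comment> \<open>Both sides are trilinear, so \<open>x\<close>, \<open>y\<close>,
    \<open>z\<close> are reduced in turn to pure tensors, where the law holds in each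
    component.\<close>
  have "?m (?m x y) z = ?m x (?m y z)" for x y z
  proof (rule lin_map_tensor_eqI[of "\<lambda>x. ?m (?m x y) z" "\<lambda>x. ?m x (?m y z)"])
    fix a b
    show "?m (?m (a \<otimes> b) y) z = ?m (a \<otimes> b) (?m y z)"
    proof (rule lin_map_tensor_eqI[of "\<lambda>y. ?m (?m (a \<otimes> b) y) z" "\<lambda>y. ?m (a \<otimes> b) (?m y z)"])
      fix a' b'
      show "?m (?m (a \<otimes> b) (a' \<otimes> b')) z = ?m (a \<otimes> b) (?m (a' \<otimes> b') z)"
        by (rule lin_map_tensor_eqI[of "\<lambda>z. ?m (?m (a \<otimes> b) (a' \<otimes> b')) z"
              "\<lambda>z. ?m (a \<otimes> b) (?m (a' \<otimes> b') z)"])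
          (simp_all add: lm t unital_algebra_assoc A B)
    qed (simp_all add: lm)
  qed (simp_all add: lm)
  moreover have "?m (unit (tensor_alg A B)) x = x" for x
    by (rule lin_map_tensor_eqI[of "\<lambda>x. ?m (unit (tensor_alg A B)) x" "\<lambda>x. x"])
      (simp_all add: lm t unit_tensor_alg unital_algebra_unit A B)
  moreover have "?m x (unit (tensor_alg A B)) = x" for x
    by (rule lin_map_tensor_eqI[of "\<lambda>x. ?m x (unit (tensor_alg A B))" "\<lambda>x. x"])
      (simp_all add: lm t unit_tensor_alg unital_algebra_unit A B)
  ultimately show ?thesis
    by (simp add: unital_algebra_def l1 l2)
qed

lemma alg_inv_eqI:
  assumes A: "unital_algebra A" and xy: "x \<cdot>\<^bsub>A\<^esub> y = \<one>\<^bsub>A\<^esub>" "y \<cdot>\<^bsub>A\<^esub> x = \<one>\<^bsub>A\<^esub>"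
  shows "alg_inv A x = y"
  unfolding alg_inv_def
proof (rule the_equality)
  fix z assume "x \<cdot>\<^bsub>A\<^esub> z = \<one>\<^bsub>A\<^esub> \<and> z \<cdot>\<^bsub>A\<^esub> x = \<one>\<^bsub>A\<^esub>"
  then show "z = y"
    by (metis A unital_algebra_assoc unital_algebra_unit xy)
qed (use xy in simp)

section \<open>Linearity of the operations on the dual\<close>

lemma lin_eval_dual: "lin_form (\<lambda>x. eval_dual x y)" "lin_form (eval_dual x)"
  by (simp_all add: lin_form_iff scalar_product_def algebra_simps sum.distrib sum_distrib_left)

lemma lin_form_comp: "lin_form g \<Longrightarrow> lin_map f \<Longrightarrow> lin_form (\<lambda>x. g (f x))"
  by (simp add: lin_form_iff lin_map_iff)

lemma lin_dual_of: "(\<And>y. lin_form (\<lambda>x. F x y)) \<Longrightarrow> lin_map (\<lambda>x. dual_of (F x))"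
  by (simp add: dual_of_def lin_map_iff lin_form_iff vec_eq_iff)

lemma lin_act:
  assumes "unital_algebra A"
  shows "lin_map (\<lambda>h. act_left A h \<phi>)" "lin_map (act_left A h)"
     "lin_map (\<lambda>\<phi>. act_right A \<phi> h)" "lin_map (act_right A \<phi>)"
  unfolding act_left_def[abs_def] act_right_def[abs_def]
  by (intro lin_dual_of lin_eval_dual lin_eval_dual[THEN lin_form_comp] unital_algebra_lin assms)+

lemma lin_conv: "lin_map (conv H \<phi>)" "lin_map (\<lambda>\<phi>. conv H \<phi> \<psi>)"
  unfolding conv_def[abs_def]
  by (intro lin_dual_of lin_eval_dual[THEN lin_form_comp] lin_map_tensor_const lin_map_const_tensor)+

lemma lin_dual_comult: "lin_map (dual_comult H)"
  unfolding dual_comult_def[abs_def]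
  by (intro lin_dual_of lin_eval_dual)

lemma numeral_mult_vec: "numeral n * v = (numeral n *s v :: 'a::comm_ring_1 ^ 'n)"
  by (simp add: vec_eq_iff)

text \<open>Interchange of finite sums. It serves to pull the expansion of \<Delta>(h) out of the
  formula for the coproduct of the double.\<close>

lemma sw_swap:
  "sw3 t (\<lambda>a b c. sw2 s (F3 a b c)) = sw2 s (\<lambda>d e. sw3 t (\<lambda>a b c. F3 a b c d e))"
  "sw2 r (\<lambda>a b. sw2 s (F2 a b)) = sw2 s (\<lambda>d e. sw2 r (\<lambda>a b. F2 a b d e))"
  unfolding sw3_def sw2_def split_def
  by (simp_all only: vec.scale_sum_right vec.scale_scale) (subst sum.swap; simp only: mult.commute)+

lemma mul_sw:
  assumes "unital_algebra A"
  shows "mul A (sw2 r F2) v = sw2 r (\<lambda>a b. mul A (F2 a b) v)"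
    "mul A v (sw2 r F2) = sw2 r (\<lambda>a b. mul A v (F2 a b))"
    "mul A (sw3 t F3) v = sw3 t (\<lambda>a b c. mul A (F3 a b c) v)"
  unfolding sw3_def sw2_def split_def
  by (simp_all add: lin_map_sum[OF unital_algebra_lin(2)[OF assms]] lin_map_scale[OF unital_algebra_lin(2)[OF assms]]
      lin_map_sum[OF unital_algebra_lin(1)[OF assms]] lin_map_scale[OF unital_algebra_lin(1)[OF assms]])

lemma lin_map_uminus: "lin_map f \<Longrightarrow> lin_map (\<lambda>x. - f x)"
  by (simp add: lin_map_iff)

lemma lin_map_const_zero: "lin_map (\<lambda>x. 0)"
  by (simp add: lin_map_iff)

lemma lin_form_mult: "lin_form f \<Longrightarrow> lin_form (\<lambda>x. f x * c)" "lin_form f \<Longrightarrow> lin_form (\<lambda>x. c * f x)"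
  by (simp_all add: lin_form_iff algebra_simps)

lemma lin_form_distribs:
  assumes "lin_form f"
  shows "f (x + y) = f x + f y" "f (x - y) = f x - f y" "f (- x) = - f x" "f (c *s x) = c * f x" "f 0 = 0"
  using assms unfolding lin_form_iff
  by (simp_all, metis add_diff_cancel_right' diff_add_cancel, metis mult_minus1 vector_sneg_minus1, metis mult_zero_left vector_smult_lzero)

section \<open>Free algebras\<close>

text \<open>An update at a fresh key is the addition of a monomial, so the library induction over
  updates becomes an induction over sums of monomials.\<close>

lemma poly_mapping_add_induct [case_names zero add]:
  fixes p :: "'w \<Rightarrow>\<^sub>0 'a::comm_monoid_add"
  assumes "P 0" and "\<And>w c p. P p \<Longrightarrow> P (Poly_Mapping.single w c + p)"
  shows "P p"
proof (induction p rule: update_induct)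
  case (update p w c)
  have "Poly_Mapping.update w c p = Poly_Mapping.single w c + p"
    using update by (intro poly_mapping_eqI) (auto simp: lookup_update lookup_add lookup_single in_keys_iff)
  then show ?case
    using assms(2) update by simp
qed (fact assms(1))

text \<open>Further words contribute zero terms. Over a common superset of the keys, the evaluations
  of \<open>p\<close>, \<open>q\<close> and \<open>p + q\<close> can be compared termwise.\<close>

lemma free_eval_superset:
  assumes "finite S" "Poly_Mapping.keys p \<subseteq> S"
  shows "free_eval A v p = (\<Sum>w\<in>S. Poly_Mapping.lookup p w *s word_eval A v w)"
  unfolding free_eval_def
  by (rule sum.mono_neutral_left) (use assms in \<open>auto simp: in_keys_iff\<close>)

lemma free_eval_zero: "free_eval A v 0 = 0"
  by (simp add: free_eval_def)

lemma free_eval_single: "free_eval A v (Poly_Mapping.single w c) = c *s word_eval A v w"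
  by (simp add: free_eval_def)

lemma free_eval_add: "free_eval A v (p + q) = free_eval A v p + free_eval A v q"
proof -
  let ?S = "Poly_Mapping.keys p \<union> Poly_Mapping.keys q"
  have fin: "finite ?S"
    by simp
  show ?thesis
    unfolding free_eval_superset[OF fin Poly_Mapping.keys_add[of p q]]
      free_eval_superset[OF fin Un_upper1] free_eval_superset[OF fin Un_upper2]
    by (simp add: lookup_add vec.scale_left_distrib sum.distrib)
qed

lemma free_eval_diff: "free_eval A v (p - q) = free_eval A v p - free_eval A v q"
  using free_eval_add[of A v "p - q" q] by (simp add: algebra_simps)

lemma word_eval_add:
  assumes "unital_algebra A"
  shows "word_eval A v (u + w) = word_eval A v u \<cdot>\<^bsub>A\<^esub> word_eval A v w"
proof -
  \<comment> \<open>Concatenation starts the first fold at the value of the second word; this start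
    value can be moved out as a right factor.\<close>
  have *: "foldr (\<lambda>x u. v x \<cdot>\<^bsub>A\<^esub> u) xs y = foldr (\<lambda>x u. v x \<cdot>\<^bsub>A\<^esub> u) xs \<one>\<^bsub>A\<^esub> \<cdot>\<^bsub>A\<^esub> y" for xs y
    by (induction xs) (simp_all add: unital_algebra_unit unital_algebra_assoc assms)
  show ?thesis
    by (simp add: word_eval_def plus_free_monoid_def) (rule *)
qed

lemma free_eval_mult:
  assumes A: "unital_algebra A"
  shows "free_eval A v (p * q) = free_eval A v p \<cdot>\<^bsub>A\<^esub> free_eval A v q"
proof (induction p rule: poly_mapping_add_induct)
  case (add w c p)
  \<comment> \<open>A second induction, on \<open>q\<close>, treats a single monomial on the left;
    the outer step then needs only additivity.\<close>
  have "free_eval A v (Poly_Mapping.single w c * q)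
      = free_eval A v (Poly_Mapping.single w c) \<cdot>\<^bsub>A\<^esub> free_eval A v q"
    by (induction q rule: poly_mapping_add_induct)
      (simp_all add: free_eval_zero free_eval_single free_eval_add mult_single word_eval_add A
        mul_distribs distrib_left vector_smult_assoc)
  with add show ?case
    by (simp add: free_eval_add distrib_right mul_distribs A)
qed (simp add: free_eval_zero mul_distribs A)

lemma free_eval_one: "free_eval A v 1 = \<one>\<^bsub>A\<^esub>"
proof -
  have "word_eval A v 0 = \<one>\<^bsub>A\<^esub>"
    by (simp add: word_eval_def zero_free_monoid_def)
  then show ?thesis
    using free_eval_single[of A v 0 1] by simp
qed

lemma free_eval_gen:
  assumes "unital_algebra A"
  shows "free_eval A v (gen x) = v x"
  by (simp add: gen_def free_eval_single word_eval_def unital_algebra_unit assms)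

lemma two_sided_ideal_ideal_generated: "two_sided_ideal (ideal_generated R)"
  unfolding ideal_generated_def two_sided_ideal_def by blast

lemma ideal_generated_superset: "R \<subseteq> ideal_generated R"
  unfolding ideal_generated_def by blast

lemma ideal_generated_least: "two_sided_ideal I \<Longrightarrow> R \<subseteq> I \<Longrightarrow> ideal_generated R \<subseteq> I"
  unfolding ideal_generated_def by blast

lemma two_sided_ideal_kernel:
  assumes "unital_algebra A"
  shows "two_sided_ideal {p. free_eval A v p = 0}"
  unfolding two_sided_ideal_def
  by (simp add: free_eval_zero free_eval_add free_eval_mult mul_distribs assms)

lemma
  assumes "two_sided_ideal I"
  shows two_sided_ideal_0: "0 \<in> I"
    and two_sided_ideal_add: "a \<in> I \<Longrightarrow> b \<in> I \<Longrightarrow> a + b \<in> I"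
    and two_sided_ideal_mult: "a \<in> I \<Longrightarrow> r * a \<in> I" "a \<in> I \<Longrightarrow> a * r \<in> I"
  using assms by (auto simp: two_sided_ideal_def)

section \<open>Normal forms modulo the relations\<close>

context
  fixes I :: "(generator, 'k::field) free_algebra set"
  assumes I: "two_sided_ideal I"
    and XX: "gen GX * gen GX - 1 \<in> I" and YY: "gen GY * gen GY - gen GX \<in> I"
begin

lemma ideal_Y4: "gen GY ^ 4 - 1 \<in> I"
proof -
  let ?X = "gen GX :: (generator, 'k) free_algebra" and ?Y = "gen GY :: (generator, 'k) free_algebra"
  \<comment> \<open>Telescoping in the free algebra: the right and then the left factor Y^2 of Y^4
    is traded for X in a suitable order, then X^2 for 1, and each trade is a multiple of a
    relation.\<close>
  have "?Y ^ 4 - 1 = (?Y * ?Y - ?X) * (?Y * ?Y) + ?X * (?Y * ?Y - ?X) + (?X * ?X - 1)"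
    by (simp add: algebra_simps eval_nat_numeral)
  moreover have "(?Y * ?Y - ?X) * (?Y * ?Y) + ?X * (?Y * ?Y - ?X) + (?X * ?X - 1) \<in> I"
    by (intro two_sided_ideal_add[OF I] two_sided_ideal_mult(1)[OF I YY] two_sided_ideal_mult(2)[OF I YY] XX)
  ultimately show ?thesis
    by (simp only:)
qed

text \<open>A further letter Y raises the exponent by one, a further letter X by two because X is
  congruent to Y^2, and \<open>ideal_Y4\<close> brings the exponent back below four.\<close>

lemma word_congruent_power:
  "\<exists>n<4. Poly_Mapping.single (Word xs) 1 - gen GY ^ n \<in> I"
proof (induction xs)
  case Nil
  have "Poly_Mapping.single (Word []) 1 = (gen GY ^ 0 :: (generator, 'k) free_algebra)"
    by (simp flip: zero_free_monoid_def)
  then show ?case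
    using two_sided_ideal_0[OF I] by (intro exI[of _ 0]) simp
next
  case (Cons x xs)
  let ?s = "Poly_Mapping.single (Word xs) 1 :: (generator, 'k) free_algebra"
  obtain n where n: "n < 4" "?s - gen GY ^ n \<in> I"
    using Cons by blast
  have s: "Poly_Mapping.single (Word (x # xs)) 1 = gen x * ?s"
    by (simp add: gen_def mult_single plus_free_monoid_def)
  \<comment> \<open>From \<open>n < 4\<close> the exponent grows by at most two, so afterwards at
    most one subtraction of 4 is needed.\<close>
  have "\<exists>m<6. gen x * ?s - gen GY ^ m \<in> I"
  proof (cases x)
    case GX
    have "gen x * ?s - gen GY ^ (n + 2) = gen GX * (?s - gen GY ^ n) + (- 1) * ((gen GY * gen GY - gen GX) * gen GY ^ n)"
      by (simp add: GX algebra_simps)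
    then have "gen x * ?s - gen GY ^ (n + 2) \<in> I"
      by (simp only:) (intro two_sided_ideal_add[OF I] two_sided_ideal_mult(1)[OF I] two_sided_ideal_mult(2)[OF I YY] n)
    then show ?thesis
      using n by (intro exI[of _ "n + 2"]) auto
  next
    case GY
    have "gen x * ?s - gen GY ^ (n + 1) = gen GY * (?s - gen GY ^ n)"
      by (simp add: GY algebra_simps)
    then have "gen x * ?s - gen GY ^ (n + 1) \<in> I"
      by (simp only:) (intro two_sided_ideal_mult(1)[OF I] n)
    then show ?thesis
      using n by (intro exI[of _ "n + 1"]) auto
  qed
  then obtain m where m: "m < 6" "gen x * ?s - gen GY ^ m \<in> I"
    by blast
  show ?case
  proof (cases "m < 4")
    case False
    then obtain l where l: "m = l + 4" "l < 4"
      using m(1) by (intro that[of "m - 4"]) auto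
    have "gen x * ?s - gen GY ^ l = (gen x * ?s - gen GY ^ m) + gen GY ^ l * (gen GY ^ 4 - 1)"
      by (simp add: l power_add algebra_simps)
    then have "gen x * ?s - gen GY ^ l \<in> I"
      by (simp only:) (intro two_sided_ideal_add[OF I] two_sided_ideal_mult(1)[OF I] m ideal_Y4)
    then show ?thesis
      using l s by auto
  qed (use m s in auto)
qed

text \<open>Scalars are written as multiples of the empty word, which makes them ring elements;
  closure of the ideal under ring multiplication then covers scaling too.\<close>

lemma congruent_cubic:
  "\<exists>c. p - (\<Sum>n<4. Poly_Mapping.single 0 (c n) * gen GY ^ n) \<in> I"
proof (induction p rule: poly_mapping_add_induct)
  case zero
  show ?case
    using two_sided_ideal_0[OF I] by (intro exI[of _ "\<lambda>_. 0"]) simp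
next
  case (add w a p)
  then obtain c where c: "p - (\<Sum>n<4. Poly_Mapping.single 0 (c n) * gen GY ^ n) \<in> I"
    by blast
  obtain m where m: "m < 4" "Poly_Mapping.single w 1 - gen GY ^ m \<in> I"
    using word_congruent_power[of "letters w"] by auto
  \<comment> \<open>A new monomial with coefficient \<open>a\<close> whose word reduces to Y^m
    changes only the coefficient at \<open>m\<close>.\<close>
  have "(\<Sum>n<4. Poly_Mapping.single 0 ((c(m := c m + a)) n) * gen GY ^ n)
      = (\<Sum>n<4. Poly_Mapping.single 0 (c n) * gen GY ^ n + (if n = m then Poly_Mapping.single 0 a * gen GY ^ m else 0))"
    by (intro sum.cong) (auto simp: single_add distrib_right)
  also have "\<dots> = (\<Sum>n<4. Poly_Mapping.single 0 (c n) * gen GY ^ n) + Poly_Mapping.single 0 a * gen GY ^ m"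
    using m(1) by (simp add: sum.distrib)
  finally have "Poly_Mapping.single w a + p - (\<Sum>n<4. Poly_Mapping.single 0 ((c(m := c m + a)) n) * gen GY ^ n)
      = Poly_Mapping.single 0 a * (Poly_Mapping.single w 1 - gen GY ^ m)
        + (p - (\<Sum>n<4. Poly_Mapping.single 0 (c n) * gen GY ^ n))"
    by (simp add: algebra_simps mult_single)
  then show ?case
    by (intro exI[of _ "c(m := c m + a)"], simp only:) (intro two_sided_ideal_add[OF I] two_sided_ideal_mult(1)[OF I] m(2) c)
qed

end

section \<open>The algebra \<open>H(2)\<close>\<close>

lemma sum_UNIV_bit: "(\<Sum>i\<in>UNIV. f i) = f 0 + f (1::bit)"
proof -
  have univ: "(UNIV :: bit set) = {0, 1}"
    by (auto intro: bit.exhaust)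
  show ?thesis by (subst univ) simp
qed

lemma all_bit_iff: "(\<forall>i::bit. P i) \<longleftrightarrow> P 0 \<and> P 1"
  by (metis bit.exhaust)

lemma vec_bit_eq_iff: "(u :: 'k ^ bit) = v \<longleftrightarrow> u $ 0 = v $ 0 \<and> u $ 1 = v $ 1"
  by (simp add: vec_eq_iff all_bit_iff)

lemma axis_nth: "axis i x $ j = (if j = i then x else 0)"
  by (simp add: axis_def)

lemma mul_group_alg_bit: "u \<cdot>\<^bsub>group_alg\<^esub> v =
    (\<chi> i. if i = (0::bit) then u $ 0 * v $ 0 + u $ 1 * v $ 1 else u $ 0 * v $ 1 + u $ 1 * v $ 0)"
  by (simp add: group_alg_def sum_UNIV_bit vec_bit_eq_iff axis_nth)

lemma unital_algebra_group_alg_bit: "unital_algebra (group_alg :: ('k::field, bit) alg)"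
  unfolding unital_algebra_def lin_map_iff mul_group_alg_bit
  by (simp add: group_alg_def vec_bit_eq_iff axis_nth algebra_simps)

lemma H2_sel: "mul H2 = mul group_alg" "unit H2 = unit group_alg"
   "antipode H2 = id" "alpha H2 = g_elem" "beta H2 = unit group_alg"
   "comult H2 = (\<lambda>u. \<Sum>a\<in>UNIV. u $ a *s (basis_vec a \<otimes> basis_vec a))"
   "counit H2 = (\<lambda>u. \<Sum>a\<in>UNIV. u $ a)"
  by (simp_all add: H2_def)

definition p_H2 :: "'k::field ^ bit" where "p_H2 = p_minus group_alg g_elem"
definition one_H2 :: "'k::field ^ bit" where "one_H2 = unit group_alg"
text \<open>The nontrivial character of the group of order two, by its values on the group
  elements.\<close>

definition chi_H2 :: "'k::field ^ bit" where "chi_H2 = (\<chi> i. if i = 0 then 1 else - 1)"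
definition eps_H2 :: "'k::field ^ bit" where "eps_H2 = counit_dual H2"

lemma one_H2_nth: "one_H2 $ i = (if i = 0 then 1 else 0)"
  by (simp add: one_H2_def group_alg_def axis_nth)

lemma unital_algebra_H2: "unital_algebra H2"
  using unital_algebra_group_alg_bit unfolding unital_algebra_def H2_sel .

lemma H2_unit: "one_H2 \<cdot>\<^bsub>H2\<^esub> x = x" "x \<cdot>\<^bsub>H2\<^esub> one_H2 = x"
  using unital_algebra_unit[OF unital_algebra_H2] by (simp_all add: one_H2_def H2_sel)

lemma sel_H2: "unit H2 = one_H2" "antipode H2 h = h" "beta H2 = one_H2" "antipode_inv H2 h = h"
  by (simp_all add: H2_sel one_H2_def antipode_inv_def)

lemma lin_comult_H2: "lin_map (comult H2)"
  by (simp add: H2_sel lin_map_iff sum_UNIV_bit vec.scale_left_distrib vec.scale_right_distrib)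

lemma eps_H2_nth: "eps_H2 $ i = 1"
  by (simp add: eps_H2_def counit_dual_def dual_of_def H2_sel sum_UNIV_bit axis_nth)

lemma chi_H2_nth: "chi_H2 $ i = (if i = 0 then 1 else - 1)"
  by (simp add: chi_H2_def)

lemma dual_antipode_H2: "dual_antipode H2 \<phi> = \<phi>"
  by (simp add: dual_antipode_def H2_sel dual_of_def vec_bit_eq_iff scalar_product_def sum_UNIV_bit axis_nth)

lemma inv_dual_antipode: "inv (dual_antipode H2) \<phi> = \<phi>"
proof -
  have "dual_antipode H2 = (id :: 'a ^ bit \<Rightarrow> _)"
    by (simp add: fun_eq_iff dual_antipode_H2)
  then show ?thesis by simp
qed

lemmas H2_coords = vec_bit_eq_iff mul_group_alg_bit scalar_product_def sum_UNIV_bit axis_nth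
  dual_of_def H2_sel eps_H2_nth chi_H2_nth one_H2_nth

lemma vec_bit2_eq_iff: "(u :: 'k ^ (bit \<times> bit)) = v \<longleftrightarrow>
   u $ (0,0) = v $ (0,0) \<and> u $ (0,1) = v $ (0,1) \<and> u $ (1,0) = v $ (1,0) \<and> u $ (1,1) = v $ (1,1)"
  by (auto simp add: vec_eq_iff all_bit_iff)

text \<open>Group elements are grouplike, so convolution is pointwise multiplication of functions on
  the group, and the two characters form the dual group.\<close>

lemma conv_H2: "conv H2 eps_H2 eps_H2 = eps_H2" "conv H2 eps_H2 chi_H2 = chi_H2" "conv H2 chi_H2 eps_H2 = chi_H2" "conv H2 chi_H2 chi_H2 = eps_H2"
  by (simp_all add: conv_def H2_coords tensor_def sum_UNIV_prod)

text \<open>A multiplicative functional is grouplike in the dual coalgebra.\<close>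

lemma dual_comult_H2: "dual_comult H2 eps_H2 = eps_H2 \<otimes> eps_H2" "dual_comult H2 chi_H2 = chi_H2 \<otimes> chi_H2"
  by (simp_all add: dual_comult_def H2_coords vec_bit2_eq_iff sw2_def tensor_def sum_UNIV_prod)

lemma act_unit_H2: "act_left H2 one_H2 \<phi> = \<phi>" "act_right H2 \<phi> one_H2 = \<phi>"
  by (simp_all add: act_left_def act_right_def H2_coords)

text \<open>If 2 = 0, the characteristic divides 2; it is then not 0, and it is not 1 because 1 and
  0 differ in a field.\<close>

lemma two_neq_zero_if_CHAR:
  assumes "CHAR('k::field) \<noteq> 2" shows "(2::'k) \<noteq> 0"
proof
  assume "(2::'k) = 0"
  then have dvd: "CHAR('k) dvd 2"
    by (metis of_nat_eq_0_iff_char_dvd of_nat_numeral)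
  have "CHAR('k) \<le> 2"
    using dvd by (simp add: dvd_imp_le)
  moreover have "CHAR('k) \<noteq> 0"
    using dvd by (metis dvd_0_left_iff zero_neq_numeral)
  moreover have "CHAR('k) \<noteq> 1"
    using of_nat_CHAR[where ?'a = 'k] by (metis of_nat_1 zero_neq_one)
  ultimately show False
    using assms by linarith
qed

text \<open>The \<open>itself\<close> parameter pins down the field, so that invertibility of 2 is
  available as a fact about that type.\<close>

locale char_not_two =
  fixes k_type :: "'k::field itself"
  assumes two_neq_zero: "(2::'k) \<noteq> 0"
begin

lemma p_H2_nth: "(p_H2::'k^bit) $ i = (if i = 0 then 1 / 2 else - (1 / 2))"
  using two_neq_zero by (cases i) (simp_all add: p_H2_def p_minus_def group_alg_def g_elem_def axis_nth)

lemma powers_of_two_neq_zero: "(4::'k) \<noteq> 0" "(8::'k) \<noteq> 0" "(16::'k) \<noteq> 0" "(32::'k) \<noteq> 0" "(64::'k) \<noteq> 0"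
  using two_neq_zero by (metis mult_2 mult_eq_0_iff numeral_Bit0)+

lemma p_H2_idem: "(p_H2::'k^bit) \<cdot>\<^bsub>H2\<^esub> p_H2 = p_H2"
  using two_neq_zero powers_of_two_neq_zero by (simp add: H2_coords p_H2_nth field_simps)

lemma g_elem_eq: "(g_elem::'k^bit) = one_H2 - 2 *s p_H2"
  using two_neq_zero by (simp add: H2_coords p_H2_nth g_elem_def)

text \<open>The second formula is (1 \<otimes> 1 - g \<otimes> g) / 2 with g = 1 - 2p
  substituted.\<close>

lemma comult_H2: "comult H2 (one_H2::'k^bit) = one_H2 \<otimes> one_H2"
    "comult H2 (p_H2::'k^bit) = p_H2 \<otimes> one_H2 + one_H2 \<otimes> p_H2 - 2 *s (p_H2 \<otimes> p_H2)"
  using two_neq_zero powers_of_two_neq_zero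
  by (simp_all add: H2_coords p_H2_nth vec_bit2_eq_iff tensor_def field_simps)

text \<open>A character is an eigenvector of both actions, with its value at p as eigenvalue: 0 for
  the counit and 1 for \<chi>.\<close>

lemma act_H2: "act_left H2 (p_H2::'k^bit) eps_H2 = 0" "act_left H2 (p_H2::'k^bit) chi_H2 = chi_H2"
   "act_right H2 eps_H2 (p_H2::'k^bit) = 0" "act_right H2 chi_H2 (p_H2::'k^bit) = chi_H2"
  using two_neq_zero
  by (simp_all add: act_left_def act_right_def H2_coords p_H2_nth)

lemma reassoc_H2: "reassoc H2 = (one_H2 \<otimes> one_H2 \<otimes> one_H2 - 2 *s (p_H2 \<otimes> p_H2 \<otimes> p_H2) :: 'k ^ (bit \<times> bit \<times> bit))"
  by (simp add: H2_def p_H2_def one_H2_def tensor_alg_def Let_def)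

lemma lin_map_eqI_H2:
  assumes "lin_map f" "lin_map g" "f one_H2 = g one_H2" "f p_H2 = g p_H2"
  shows "f u = g (u :: 'k ^ bit)"
proof -
  \<comment> \<open>Substitute g = 1 - 2p in the expansion of \<open>u\<close> in group
    elements.\<close>
  have "u = (u $ 0 + u $ 1) *s one_H2 - (2 * u $ 1) *s p_H2"
    using two_neq_zero by (simp add: H2_coords p_H2_nth)
  then show ?thesis
    by (metis assms lin_map_diff lin_map_scale)
qed

lemma lin_map_eqI_dual_H2:
  assumes "lin_map f" "lin_map g" "f eps_H2 = g eps_H2" "f chi_H2 = g chi_H2"
  shows "f u = g (u :: 'k ^ bit)"
proof -
  \<comment> \<open>Fourier coefficients on the group of order two.\<close>
  have "u = ((u $ 0 + u $ 1) / 2) *s eps_H2 + ((u $ 0 - u $ 1) / 2) *s chi_H2"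
    using two_neq_zero by (simp add: H2_coords add_divide_distrib[symmetric] diff_divide_distrib[symmetric])
  then show ?thesis
    by (metis assms lin_map_add lin_map_scale)
qed

section \<open>Reassociator, twist and \<open>Omega\<close> of H(2)\<close>

lemma alpha_H2: "alpha H2 = one_H2 - 2 *s (p_H2 :: 'k ^ bit)"
  by (simp add: H2_sel g_elem_eq)

lemma lin_antipode_H2: "lin_map (antipode H2)" "lin_map (antipode_inv H2)"
  by (simp_all add: lin_map_iff sel_H2)

lemmas H2_lin = lin_map_plus lin_map_subtract lin_antipode_H2[THEN lin_map_comp] lin_intros lin_mul lin_comult_H2[THEN lin_map_comp]
  lin_act[OF unital_algebra_H2, THEN lin_map_comp] lin_conv[THEN lin_map_comp]
  lin_dual_comult[THEN lin_map_comp] lin_antipode_H2 unital_algebra_lin lin_comult_H2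
  lin_act[OF unital_algebra_H2] lin_conv lin_dual_comult lin_map_tensor_const lin_map_const_tensor

lemmas H2_distribs = sw_distribs tensor_distribs mul_distribs lin_map_distribs[OF lin_comult_H2]

lemmas H2_eval = sw2_tensor sw3_tensor sw4_tensor sw5_tensor unital_algebra_H2
  unital_algebra_tensor_alg mul_tensor_alg
  H2_distribs H2_unit p_H2_idem comult_H2 reassoc_H2 sel_H2 alpha_H2 act_H2 act_unit_H2 conv_H2 dual_comult_H2
  vector_smult_assoc numeral_mult_vec

text \<open>The tensor cube of p is an idempotent e, and (1 - 2e)^2 = 1, so the reassociator is its
  own inverse.\<close>

lemma reassoc_inv_H2: "reassoc_inv H2 = (one_H2 \<otimes> one_H2 \<otimes> one_H2 - 2 *s (p_H2 \<otimes> p_H2 \<otimes> p_H2) :: 'k ^ (bit \<times> bit \<times> bit))"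
  unfolding reassoc_inv_def
  by (rule alg_inv_eqI) (simp_all add: H2_eval unit_tensor_alg vec_eq_iff)

text \<open>Since the antipode is the identity and \<beta> = 1, the last two legs of the inverse
  reassociator are simply multiplied, and p is idempotent.\<close>

lemma p_R_H2: "p_R H2 = one_H2 \<otimes> one_H2 - 2 *s (p_H2 \<otimes> p_H2 :: 'k ^ (bit \<times> bit))"
  unfolding p_R_def
  by (simp add: H2_eval H2_lin reassoc_inv_H2 cong: sw_congs)

lemma gamma_elem_H2: "gamma_elem H2 =
    one_H2 \<otimes> one_H2 - 2 *s (p_H2 \<otimes> one_H2) - 2 *s (one_H2 \<otimes> p_H2) + 2 *s (p_H2 \<otimes> p_H2 :: 'k ^ (bit \<times> bit))"
  unfolding gamma_elem_def A_elem_def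
  by (simp add: H2_eval H2_lin reassoc_inv_H2 cong: sw_congs) (simp add: vec_eq_iff)

text \<open>Both outer factors of the nontrivial term equal the idempotent \<Delta>(p), so the twist
  is \<gamma> (1 - 2 \<Delta>(p)) = \<gamma> \<Delta>(g). On the idempotents \<gamma> is 1 at (0,0)
  and -1 elsewhere; \<Delta>(g) flips the two mixed pairs.\<close>

lemma f_elem_H2: "f_elem H2 = one_H2 \<otimes> one_H2 - 2 *s (p_H2 \<otimes> p_H2 :: 'k ^ (bit \<times> bit))"
  unfolding f_elem_def
  by (simp add: H2_eval H2_lin reassoc_inv_H2 gamma_elem_H2 cong: sw_congs) (simp add: vec_eq_iff)

lemma f_inv_H2: "f_inv H2 = one_H2 \<otimes> one_H2 - 2 *s (p_H2 \<otimes> p_H2 :: 'k ^ (bit \<times> bit))"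
  unfolding f_inv_def f_elem_H2
  by (rule alg_inv_eqI) (simp_all add: H2_eval unit_tensor_alg vec_eq_iff)

text \<open>The element \<open>q_R\<close> is the sign (-1)^(ij) times 1 \<otimes> g, with g coming
  from \<alpha>. In \<open>U_elem\<close> its legs are swapped and the sign cancels against the
  inverse twist, which leaves g \<otimes> 1.\<close>

lemma U_elem_H2: "U_elem H2 = one_H2 \<otimes> one_H2 - 2 *s (p_H2 \<otimes> one_H2 :: 'k ^ (bit \<times> bit))"
  unfolding U_elem_def q_R_def
  by (simp add: H2_eval H2_lin f_inv_H2 cong: sw_congs) (simp add: vec_eq_iff)

lemmas H2_lin_intros = H2_lin unital_algebra_H2 unital_algebra_tensor_alg

text \<open>This and the next three rules replace one Sweedler sum by its few pure tensors while the
  body stays abstract. Nested sums are thus removed from the outside inwards, each time with only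
  linearity to check.\<close>

lemma sw3_reassoc_H2:
  assumes "\<And>b c. lin_map (\<lambda>a. F a b c)" "\<And>a c. lin_map (\<lambda>b. F a b c)" "\<And>a b. lin_map (\<lambda>c. F a b c)"
  shows "sw3 (reassoc H2) F = F one_H2 one_H2 (one_H2 :: 'k ^ bit) - 2 *s F p_H2 p_H2 p_H2"
  by (simp add: reassoc_H2 H2_distribs sw3_tensor sw2_tensor assms)

lemma sw3_reassoc_inv_H2:
  assumes "\<And>b c. lin_map (\<lambda>a. F a b c)" "\<And>a c. lin_map (\<lambda>b. F a b c)" "\<And>a b. lin_map (\<lambda>c. F a b c)"
  shows "sw3 (reassoc_inv H2) F = F one_H2 one_H2 (one_H2 :: 'k ^ bit) - 2 *s F p_H2 p_H2 p_H2"
  by (simp add: reassoc_inv_H2 H2_distribs sw3_tensor sw2_tensor assms)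

lemma sw2_f_elem_H2:
  assumes "\<And>b. lin_map (\<lambda>a. F a b)" "\<And>a. lin_map (\<lambda>b. F a b)"
  shows "sw2 (f_elem H2) F = F one_H2 (one_H2 :: 'k ^ bit) - 2 *s F p_H2 p_H2"
  by (simp add: f_elem_H2 H2_distribs sw2_tensor assms)

lemma sw2_comult_H2:
  assumes "\<And>b. lin_map (\<lambda>a. F a b)" "\<And>a. lin_map (\<lambda>b. F a b)"
  shows "sw2 (comult H2 one_H2) F = F one_H2 (one_H2 :: 'k ^ bit)"
    "sw2 (comult H2 p_H2) F = F p_H2 one_H2 + F one_H2 (p_H2 :: 'k ^ bit) - 2 *s F p_H2 p_H2"
  by (simp_all add: comult_H2 H2_distribs sw2_tensor assms)

text \<open>On the idempotents labelled a, b, c, d, e this is the sign with exponent abc + a(b+c)d +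
  (a+b+c)de + de; the summands come from y, x, X and f in this order.\<close>

lemma Omega_H2: "Omega H2 = (one_H2 \<otimes> one_H2 \<otimes> one_H2 \<otimes> one_H2 \<otimes> one_H2
    - 2 *s (one_H2 \<otimes> one_H2 \<otimes> one_H2 \<otimes> p_H2 \<otimes> p_H2) + 2 *s (one_H2 \<otimes> one_H2 \<otimes> p_H2 \<otimes> p_H2 \<otimes> p_H2)
    + 2 *s (one_H2 \<otimes> p_H2 \<otimes> one_H2 \<otimes> p_H2 \<otimes> p_H2) - 4 *s (one_H2 \<otimes> p_H2 \<otimes> p_H2 \<otimes> p_H2 \<otimes> p_H2)
    + 2 *s (p_H2 \<otimes> one_H2 \<otimes> one_H2 \<otimes> p_H2 \<otimes> p_H2) - 2 *s (p_H2 \<otimes> one_H2 \<otimes> p_H2 \<otimes> p_H2 \<otimes> one_H2)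
    - 2 *s (p_H2 \<otimes> p_H2 \<otimes> one_H2 \<otimes> p_H2 \<otimes> one_H2) - 2 *s (p_H2 \<otimes> p_H2 \<otimes> p_H2 \<otimes> one_H2 \<otimes> one_H2)
    + 4 *s (p_H2 \<otimes> p_H2 \<otimes> p_H2 \<otimes> p_H2 \<otimes> one_H2) :: 'k ^ (bit \<times> bit \<times> bit \<times> bit \<times> bit))"
  unfolding Omega_def
  apply (subst sw3_reassoc_H2, (intro H2_lin_intros; fail)+)
  apply (subst sw3_reassoc_inv_H2, (intro H2_lin_intros; fail)+)+
  apply (subst sw2_f_elem_H2, (intro H2_lin_intros; fail)+)+
  apply (subst sw2_comult_H2, (intro H2_lin_intros; fail)+)+
  by (simp add: H2_eval) (simp add: vec_eq_iff)

end

section \<open>The quantum double of \<open>H(2)\<close>\<close>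

definition one_D :: "'k::field ^ (bit \<times> bit)" where "one_D = eps_H2 \<otimes> one_H2"
definition p_D :: "'k::field ^ (bit \<times> bit)" where "p_D = eps_H2 \<otimes> p_H2"
definition y_D :: "'k::field ^ (bit \<times> bit)" where "y_D = chi_H2 \<otimes> one_H2"
definition py_D :: "'k::field ^ (bit \<times> bit)" where "py_D = chi_H2 \<otimes> p_H2"

lemmas basis_double_defs = one_D_def p_D_def y_D_def py_D_def

lemma mul_double_alg_sw: "mul (double_alg H) u v = sw2 u (\<lambda>\<phi> h. sw2 v (\<lambda>\<psi> h'.
        sw5 (Omega H) (\<lambda>O1 O2 O3 O4 O5. sw2 (comult H h) (\<lambda>h_1 h_2. sw2 (comult H h_1) (\<lambda>h11 h12.
          (conv H (act_left H O1 (act_right H \<phi> O5))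
             (act_left H (mul H O2 h11) (act_right H \<psi> (mul H (antipode_inv H h_2) O4)))) \<otimes> (mul H (mul H O3 h12) h'))))))"
  by (simp add: double_alg_def)

section \<open>Multiplication of the double on a basis\<close>

context char_not_two begin

lemma sw5_Omega_H2:
  assumes "\<And>b c d e. lin_map (\<lambda>a. F a b c d e)" "\<And>a c d e. lin_map (\<lambda>b. F a b c d e)"
    "\<And>a b d e. lin_map (\<lambda>c. F a b c d e)" "\<And>a b c e. lin_map (\<lambda>d. F a b c d e)"
    "\<And>a b c d. lin_map (\<lambda>e. F a b c d e)"
  shows "sw5 (Omega H2) F = F one_H2 one_H2 one_H2 one_H2 (one_H2 :: 'k ^ bit)
    - 2 *s F one_H2 one_H2 one_H2 p_H2 p_H2 + 2 *s F one_H2 one_H2 p_H2 p_H2 p_H2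
    + 2 *s F one_H2 p_H2 one_H2 p_H2 p_H2 - 4 *s F one_H2 p_H2 p_H2 p_H2 p_H2
    + 2 *s F p_H2 one_H2 one_H2 p_H2 p_H2 - 2 *s F p_H2 one_H2 p_H2 p_H2 one_H2
    - 2 *s F p_H2 p_H2 one_H2 p_H2 one_H2 - 2 *s F p_H2 p_H2 p_H2 one_H2 one_H2
    + 4 *s F p_H2 p_H2 p_H2 p_H2 one_H2"
  by (simp add: Omega_H2 H2_distribs sw5_tensor sw4_tensor sw3_tensor sw2_tensor assms)

lemmas act_conv_distribs = lin_act[OF unital_algebra_H2, THEN lin_map_add] lin_act[OF unital_algebra_H2, THEN lin_map_diff]
  lin_act[OF unital_algebra_H2, THEN lin_map_scale] lin_act[OF unital_algebra_H2, THEN lin_map_zero]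
  lin_conv[THEN lin_map_zero]

lemma double_mul_tensor:
  "mul (double_alg H2) (\<phi> \<otimes> h) (\<psi> \<otimes> h') =
     sw5 (Omega H2) (\<lambda>O1 O2 O3 O4 O5. sw2 (comult H2 h) (\<lambda>h_1 h_2. sw2 (comult H2 h_1) (\<lambda>h11 h12.
          (conv H2 (act_left H2 O1 (act_right H2 \<phi> O5))
             (act_left H2 (mul H2 O2 h11) (act_right H2 \<psi> (mul H2 (antipode_inv H2 h_2) O4)))) \<otimes> (mul H2 (mul H2 O3 h12) (h' :: 'k ^ bit)))))"
  unfolding mul_double_alg_sw by (subst sw2_tensor, (intro H2_lin_intros; fail)+)+ (rule refl)

text \<open>\<open>h'\<close> enters only as a right factor of the last leg and can stay arbitrary.
  The characters evaluate the other legs of \<open>Omega\<close>, and a sign g = 1 - 2p survives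
  only when both functionals are \<chi>.\<close>

lemma double_mul_basis:
  fixes h' :: "'k ^ bit"
  shows "mul (double_alg H2) (eps_H2 \<otimes> one_H2) (eps_H2 \<otimes> h') = eps_H2 \<otimes> h'"
   "mul (double_alg H2) (eps_H2 \<otimes> one_H2) (chi_H2 \<otimes> h') = chi_H2 \<otimes> h'"
   "mul (double_alg H2) (chi_H2 \<otimes> one_H2) (eps_H2 \<otimes> h') = chi_H2 \<otimes> h'"
   "mul (double_alg H2) (chi_H2 \<otimes> one_H2) (chi_H2 \<otimes> h') = eps_H2 \<otimes> (h' - 2 *s (p_H2 \<cdot>\<^bsub>H2\<^esub> h'))"
   "mul (double_alg H2) (eps_H2 \<otimes> p_H2) (eps_H2 \<otimes> h') = eps_H2 \<otimes> (p_H2 \<cdot>\<^bsub>H2\<^esub> h')"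
   "mul (double_alg H2) (eps_H2 \<otimes> p_H2) (chi_H2 \<otimes> h') = chi_H2 \<otimes> (p_H2 \<cdot>\<^bsub>H2\<^esub> h')"
   "mul (double_alg H2) (chi_H2 \<otimes> p_H2) (eps_H2 \<otimes> h') = chi_H2 \<otimes> (p_H2 \<cdot>\<^bsub>H2\<^esub> h')"
   "mul (double_alg H2) (chi_H2 \<otimes> p_H2) (chi_H2 \<otimes> h') = - (eps_H2 \<otimes> (p_H2 \<cdot>\<^bsub>H2\<^esub> h'))"
  unfolding double_mul_tensor
  by (subst sw5_Omega_H2, (intro H2_lin_intros; fail)+, (subst sw2_comult_H2, (intro H2_lin_intros; fail)+)+,
      (simp add: H2_eval act_conv_distribs; simp add: vec_eq_iff))+

lemma lin_map_eqI_double: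
  assumes f: "lin_map f" and g: "lin_map g"
    and eq: "f one_D = g one_D" "f p_D = g p_D" "f y_D = g y_D" "f py_D = g py_D"
  shows "f u = g (u :: 'k ^ (bit \<times> bit))"
proof (rule lin_map_tensor_eqI[OF f g])
  fix \<phi> h :: "'k ^ bit"
  note lin = lin_map_comp[OF f] lin_map_comp[OF g] lin_map_tensor_const lin_map_const_tensor
  have "f (eps_H2 \<otimes> h) = g (eps_H2 \<otimes> h)"
    by (rule lin_map_eqI_H2[of "\<lambda>h. f (eps_H2 \<otimes> h)" "\<lambda>h. g (eps_H2 \<otimes> h)"], (intro lin)+)
      (use eq in \<open>simp_all add: basis_double_defs\<close>)
  moreover have "f (chi_H2 \<otimes> h) = g (chi_H2 \<otimes> h)"
    by (rule lin_map_eqI_H2[of "\<lambda>h. f (chi_H2 \<otimes> h)" "\<lambda>h. g (chi_H2 \<otimes> h)"], (intro lin)+)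
      (use eq in \<open>simp_all add: basis_double_defs\<close>)
  ultimately show "f (\<phi> \<otimes> h) = g (\<phi> \<otimes> h)"
    by (rule lin_map_eqI_dual_H2[of "\<lambda>\<phi>. f (\<phi> \<otimes> h)" "\<lambda>\<phi>. g (\<phi> \<otimes> h)", rotated 2]; intro lin)
qed

end

definition DH2 :: "('k::field, bit \<times> bit) quasi_hopf" where "DH2 = quantum_double H2"

lemma DH2_sel: "mul DH2 = mul (double_alg H2)" "unit DH2 = one_D" "comult DH2 = double_comult H2"
  "counit DH2 = double_counit H2" "antipode DH2 = double_antipode H2" "alpha DH2 = eps_H2 \<otimes> alpha H2"
  "beta DH2 = one_D"
  by (simp_all add: DH2_def quantum_double_def i_D_def double_alg_def one_D_def eps_H2_def sel_H2 H2_sel one_H2_def)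

lemma lin_double_maps: "lin_map (double_comult H)" "lin_map (double_antipode H)" "lin_form (double_counit H)"
  unfolding double_comult_def[abs_def] double_antipode_def[abs_def] double_counit_def[abs_def]
  by (intro lin_map_sw lin_eval_dual)+

lemmas lin_DH2_maps = lin_double_maps[of H2, folded DH2_sel]

lemma lin_DH2_mul: "lin_map (mul DH2 x)" "lin_map (\<lambda>y. mul DH2 y x)"
  unfolding DH2_sel mul_double_alg_sw by (intro lin_intros)+

context char_not_two begin

text \<open>P is a central idempotent; Y squares to the unit on the summand cut out by 1 - P and to
  minus the unit on the one cut out by P.\<close>

lemma mul_DH2:
  "one_D \<cdot>\<^bsub>DH2\<^esub> one_D = (one_D :: 'k ^ (bit \<times> bit))"
  "one_D \<cdot>\<^bsub>DH2\<^esub> p_D = (p_D :: 'k ^ (bit \<times> bit))"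
  "one_D \<cdot>\<^bsub>DH2\<^esub> y_D = (y_D :: 'k ^ (bit \<times> bit))"
  "one_D \<cdot>\<^bsub>DH2\<^esub> py_D = (py_D :: 'k ^ (bit \<times> bit))"
  "p_D \<cdot>\<^bsub>DH2\<^esub> one_D = (p_D :: 'k ^ (bit \<times> bit))"
  "p_D \<cdot>\<^bsub>DH2\<^esub> p_D = (p_D :: 'k ^ (bit \<times> bit))"
  "p_D \<cdot>\<^bsub>DH2\<^esub> y_D = (py_D :: 'k ^ (bit \<times> bit))"
  "p_D \<cdot>\<^bsub>DH2\<^esub> py_D = (py_D :: 'k ^ (bit \<times> bit))"
  "y_D \<cdot>\<^bsub>DH2\<^esub> one_D = (y_D :: 'k ^ (bit \<times> bit))"
  "y_D \<cdot>\<^bsub>DH2\<^esub> p_D = (py_D :: 'k ^ (bit \<times> bit))"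
  "y_D \<cdot>\<^bsub>DH2\<^esub> y_D = (one_D - 2 *s p_D :: 'k ^ (bit \<times> bit))"
  "y_D \<cdot>\<^bsub>DH2\<^esub> py_D = (- p_D :: 'k ^ (bit \<times> bit))"
  "py_D \<cdot>\<^bsub>DH2\<^esub> one_D = (py_D :: 'k ^ (bit \<times> bit))"
  "py_D \<cdot>\<^bsub>DH2\<^esub> p_D = (py_D :: 'k ^ (bit \<times> bit))"
  "py_D \<cdot>\<^bsub>DH2\<^esub> y_D = (- p_D :: 'k ^ (bit \<times> bit))"
  "py_D \<cdot>\<^bsub>DH2\<^esub> py_D = (- p_D :: 'k ^ (bit \<times> bit))"
  unfolding basis_double_defs DH2_sel
  by (simp add: double_mul_basis H2_eval; simp add: vec_eq_iff)+

lemmas DH2_mul_distribs = lin_map_distribs[OF lin_DH2_mul(1)] lin_map_distribs[OF lin_DH2_mul(2)]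

lemma mul_DH2_assoc_basis:
  assumes "a \<in> {one_D, p_D, y_D, py_D :: 'k ^ (bit \<times> bit)}" "b \<in> {one_D, p_D, y_D, py_D}" "c \<in> {one_D, p_D, y_D, py_D}"
  shows "a \<cdot>\<^bsub>DH2\<^esub> b \<cdot>\<^bsub>DH2\<^esub> c = a \<cdot>\<^bsub>DH2\<^esub> (b \<cdot>\<^bsub>DH2\<^esub> c)"
  using assms by (elim insertE emptyE) (simp_all add: mul_DH2 DH2_mul_distribs vector_smult_assoc numeral_mult_vec)

lemma lin_map_eqI_double_basis:
  assumes f: "lin_map f" and g: "lin_map g"
    and eq: "\<And>a. a \<in> {one_D, p_D, y_D, py_D} \<Longrightarrow> f a = g a"
  shows "f u = g (u :: 'k ^ (bit \<times> bit))"
  by (rule lin_map_eqI_double[OF f g]) (simp_all add: eq)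

lemma unital_algebra_DH2: "unital_algebra (DH2 :: ('k, bit \<times> bit) quasi_hopf)"
proof -
  let ?m = "mul (DH2 :: ('k, bit \<times> bit) quasi_hopf)"
  note lin = lin_map_id lin_DH2_mul[THEN lin_map_comp]
  \<comment> \<open>Associativity spreads from the basis to all vectors one argument at a time:
    \<open>z\<close>, then \<open>y\<close>, then \<open>x\<close>.\<close>
  have 1: "?m (?m a b) z = ?m a (?m b z)" if "a \<in> {one_D, p_D, y_D, py_D}" "b \<in> {one_D, p_D, y_D, py_D}" for a b z
    by (rule lin_map_eqI_double_basis[of "\<lambda>z. ?m (?m a b) z" "\<lambda>z. ?m a (?m b z)"])
      (intro lin, intro lin, rule mul_DH2_assoc_basis[OF that])
  have 2: "?m (?m a y) z = ?m a (?m y z)" if "a \<in> {one_D, p_D, y_D, py_D}" for a y z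
    by (rule lin_map_eqI_double_basis[of "\<lambda>y. ?m (?m a y) z" "\<lambda>y. ?m a (?m y z)"])
      (intro lin, intro lin, rule 1[OF that])
  have "?m (?m x y) z = ?m x (?m y z)" for x y z
    by (rule lin_map_eqI_double_basis[of "\<lambda>x. ?m (?m x y) z" "\<lambda>x. ?m x (?m y z)"])
      (intro lin, intro lin, rule 2)
  moreover have "?m one_D x = x" for x
    by (rule lin_map_eqI_double[of "\<lambda>x. ?m one_D x" "\<lambda>x. x"], intro lin, intro lin) (simp_all add: mul_DH2)
  moreover have "?m x one_D = x" for x
    by (rule lin_map_eqI_double[of "\<lambda>x. ?m x one_D" "\<lambda>x. x"], intro lin, intro lin) (simp_all add: mul_DH2)
  ultimately show ?thesis
    unfolding unital_algebra_def DH2_sel(2) using lin_DH2_mul by blast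
qed

section \<open>Coproduct, counit and antipode of the double\<close>

lemma sw2_p_R_H2:
  assumes "\<And>b. lin_map (\<lambda>a. F a b)" "\<And>a. lin_map (\<lambda>b. F a b)"
  shows "sw2 (p_R H2) F = F one_H2 (one_H2 :: 'k ^ bit) - 2 *s F p_H2 p_H2"
  by (simp add: p_R_H2 H2_distribs sw2_tensor assms)

lemma sw2_U_elem_H2:
  assumes "\<And>b. lin_map (\<lambda>a. F a b)" "\<And>a. lin_map (\<lambda>b. F a b)"
  shows "sw2 (U_elem H2) F = F one_H2 (one_H2 :: 'k ^ bit) - 2 *s F p_H2 one_H2"
  by (simp add: U_elem_H2 H2_distribs sw2_tensor assms)

lemma sw2_dual_comult_H2:
  assumes "\<And>b. lin_map (\<lambda>a. F a b)" "\<And>a. lin_map (\<lambda>b. F a b)"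
  shows "sw2 (dual_comult H2 eps_H2) F = F eps_H2 (eps_H2 :: 'k ^ bit)"
    "sw2 (dual_comult H2 chi_H2) F = F chi_H2 (chi_H2 :: 'k ^ bit)"
  by (simp_all add: dual_comult_H2 H2_distribs sw2_tensor assms)

lemmas lin_double_mul = lin_DH2_mul[unfolded DH2_sel(1)]

lemmas D_lin_intros = lin_double_mul[THEN lin_map_comp] H2_lin_intros

lemmas D_distribs = lin_map_distribs[OF lin_double_mul(1)] lin_map_distribs[OF lin_double_mul(2)]

lemma double_counit_basis:
  "double_counit H2 (one_D :: 'k ^ (bit \<times> bit)) = 1" "double_counit H2 (p_D :: 'k ^ (bit \<times> bit)) = 0"
  "double_counit H2 (y_D :: 'k ^ (bit \<times> bit)) = - 1" "double_counit H2 (py_D :: 'k ^ (bit \<times> bit)) = 0"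
  using two_neq_zero
  by (simp_all add: double_counit_def basis_double_defs eps_H2_def[symmetric] tensor_def scalar_product_def sum_UNIV_prod
    sum_UNIV_bit eps_H2_nth chi_H2_nth one_H2_nth p_H2_nth antipode_inv_def H2_sel g_elem_def axis_nth)

text \<open>This absorbs right factors from the image of \<open>i_D\<close> into the second leg, as
  the two factorisations of the structure maps below require.\<close>

lemma double_mul_right: "mul (double_alg H2) (\<phi> \<otimes> h) (eps_H2 \<otimes> h') = \<phi> \<otimes> (h \<cdot>\<^bsub>H2\<^esub> (h' :: 'k ^ bit))"
proof (rule lin_map_eqI_dual_H2[of "\<lambda>\<phi>. mul (double_alg H2) (\<phi> \<otimes> h) (eps_H2 \<otimes> h')"])
  show "mul (double_alg H2) (eps_H2 \<otimes> h) (eps_H2 \<otimes> h') = eps_H2 \<otimes> (h \<cdot>\<^bsub>H2\<^esub> h')"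
    by (rule lin_map_eqI_H2[of "\<lambda>h. mul (double_alg H2) (eps_H2 \<otimes> h) (eps_H2 \<otimes> h')"], (intro D_lin_intros; fail)+)
      (simp_all add: double_mul_basis H2_unit)
  show "mul (double_alg H2) (chi_H2 \<otimes> h) (eps_H2 \<otimes> h') = chi_H2 \<otimes> (h \<cdot>\<^bsub>H2\<^esub> h')"
    by (rule lin_map_eqI_H2[of "\<lambda>h. mul (double_alg H2) (chi_H2 \<otimes> h) (eps_H2 \<otimes> h')"], (intro D_lin_intros; fail)+)
      (simp_all add: double_mul_basis H2_unit)
qed (intro D_lin_intros; fail)+

text \<open>
  \<open>\<Delta>\<^sub>D(\<phi> \<bowtie> h) = \<Delta>\<^sub>D(\<phi> \<bowtie> 1) \<Delta>\<^sub>D(i\<^sub>D(h))\<close>, which leaves only \<open>h = 1\<close> to be expanded in full;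
  \<open>double_antipode_tensor\<close> below plays the same role for the antipode.
\<close>

lemma double_comult_tensor:
  fixes h :: "'k ^ bit"
  shows "double_comult H2 (\<phi> \<otimes> h) = sw2 (comult H2 h) (\<lambda>h_1 h_2.
    double_comult H2 (\<phi> \<otimes> one_H2) \<cdot>\<^bsub>T2 DH2\<^esub> ((eps_H2 \<otimes> h_1) \<otimes> (eps_H2 \<otimes> h_2)))"
proof -
  have *: "double_comult H2 (\<phi> \<otimes> h') = sw2 (comult H2 h') (\<lambda>h_1 h_2.
    sw3 (reassoc H2) (\<lambda>X1 X2 X3. sw3 (reassoc H2) (\<lambda>Y1 Y2 Y3. sw3 (reassoc_inv H2) (\<lambda>x1 x2 x3. sw2 (p_R H2) (\<lambda>p1 p2.
    sw2 (comult H2 p1) (\<lambda>p1_1 p1_2. sw2 (comult H2 X2) (\<lambda>X2_1 X2_2.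
    sw2 (dual_comult H2 \<phi>) (\<lambda>\<phi>1 \<phi>2.
      (i_D H2 (X1 \<cdot>\<^bsub>H2\<^esub> Y1) \<cdot>\<^bsub>double_alg H2\<^esub>
        (act_left H2 (p1_1 \<cdot>\<^bsub>H2\<^esub> x1) (act_right H2 \<phi>2 (Y2 \<cdot>\<^bsub>H2\<^esub> antipode_inv H2 p2)) \<otimes> (p1_2 \<cdot>\<^bsub>H2\<^esub> x2 \<cdot>\<^bsub>H2\<^esub> h_1)))
      \<otimes> (act_left H2 X2_1 (act_right H2 \<phi>1 (antipode_inv H2 X3)) \<otimes> (X2_2 \<cdot>\<^bsub>H2\<^esub> Y3 \<cdot>\<^bsub>H2\<^esub> x3 \<cdot>\<^bsub>H2\<^esub> h_2))))))))))"
    for h' :: "'k ^ bit"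
  proof -
    \<comment> \<open>Naming the expansion of \<Delta>(h') lets \<open>swap\<close> move exactly
      this sum outwards; plain swapping of any two sums would not terminate.\<close>
    define W :: "('k ^ bit \<Rightarrow> 'k ^ bit \<Rightarrow> 'k ^ ((bit \<times> bit) \<times> (bit \<times> bit))) \<Rightarrow> _"
      where "W = sw2 (comult H2 h')"
    have swap: "sw3 t (\<lambda>a b c. W (F a b c)) = W (\<lambda>d e. sw3 t (\<lambda>a b c. F a b c d e))"
      "sw2 r (\<lambda>a b. W (G a b)) = W (\<lambda>d e. sw2 r (\<lambda>a b. G a b d e))"
      for t :: "'k ^ (bit \<times> bit \<times> bit)" and r :: "'k ^ (bit \<times> bit)" and F G
      unfolding W_def by (rule sw_swap)+
    show ?thesis
      unfolding double_comult_def i_D_def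
      by (subst sw2_tensor, (intro D_lin_intros; fail)+, fold W_def) (simp only: swap)
  qed
  show ?thesis
    \<comment> \<open>As \<Delta>(1) = 1 \<otimes> 1, the factor for \<open>one_H2\<close> has no
      remaining sum over \<Delta>; \<open>h_1\<close> and \<open>h_2\<close> enter its two tensor
      legs from the right by \<open>double_mul_right\<close> and associativity.\<close>
    unfolding *[of one_H2]
    by (subst sw2_comult_H2, unfold i_D_def, (intro D_lin_intros; fail)+)
      (simp only: *[of h] mul_sw unital_algebra_tensor_alg unital_algebra_DH2 mul_tensor_alg
        unital_algebra_assoc[OF unital_algebra_DH2, unfolded DH2_sel(1)] DH2_sel(1) double_mul_right H2_unit i_D_def
        unital_algebra_assoc[OF unital_algebra_H2])
qed

lemma double_comult_one_D: "double_comult H2 (one_D :: 'k ^ (bit \<times> bit)) = one_D \<otimes> one_D"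
  unfolding double_comult_def basis_double_defs i_D_def eps_H2_def[symmetric]
  apply (subst sw2_tensor, (intro D_lin_intros; fail)+)
  apply (subst sw3_reassoc_H2, (intro D_lin_intros; fail)+)+
  apply (subst sw3_reassoc_inv_H2, (intro D_lin_intros; fail)+)+
  apply (subst sw2_p_R_H2, (intro D_lin_intros; fail)+)+
  apply (subst sw2_comult_H2 sw2_dual_comult_H2, (intro D_lin_intros; fail)+)+
  by (simp add: double_mul_basis H2_eval D_distribs act_conv_distribs; simp add: vec_eq_iff)

lemma double_comult_y_D: "double_comult H2 (y_D :: 'k ^ (bit \<times> bit)) = - (y_D \<otimes> y_D) + 2 *s (py_D \<otimes> py_D)"
  unfolding double_comult_def basis_double_defs i_D_def eps_H2_def[symmetric]
  apply (subst sw2_tensor, (intro D_lin_intros; fail)+)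
  apply (subst sw3_reassoc_H2, (intro D_lin_intros; fail)+)+
  apply (subst sw3_reassoc_inv_H2, (intro D_lin_intros; fail)+)+
  apply (subst sw2_p_R_H2, (intro D_lin_intros; fail)+)+
  apply (subst sw2_comult_H2 sw2_dual_comult_H2, (intro D_lin_intros; fail)+)+
  by (simp add: double_mul_basis H2_eval D_distribs act_conv_distribs; simp add: vec_eq_iff)

lemma double_comult_p_D: "double_comult H2 (p_D :: 'k ^ (bit \<times> bit)) = p_D \<otimes> one_D + one_D \<otimes> p_D - 2 *s (p_D \<otimes> p_D)"
  unfolding p_D_def double_comult_tensor[of eps_H2 p_H2]
  by (subst sw2_comult_H2, (intro H2_lin_intros unital_algebra_DH2; fail)+)
    (simp add: double_comult_one_D mul_tensor_alg unital_algebra_DH2 mul_DH2 flip: basis_double_defs)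

lemma double_comult_py_D: "double_comult H2 (py_D :: 'k ^ (bit \<times> bit)) = - (py_D \<otimes> y_D) - (y_D \<otimes> py_D) + 2 *s (py_D \<otimes> py_D)"
  unfolding py_D_def double_comult_tensor[of chi_H2 p_H2]
  by (subst sw2_comult_H2, (intro H2_lin_intros unital_algebra_DH2; fail)+)
    (simp add: double_comult_y_D mul_tensor_alg unital_algebra_tensor_alg unital_algebra_DH2 mul_DH2 mul_distribs
      tensor_distribs vector_smult_assoc flip: basis_double_defs; simp add: vec_eq_iff)

lemma unital_algebra_double_alg: "unital_algebra (double_alg (H2 :: ('k, bit) quasi_hopf))"
  using unital_algebra_DH2 unfolding unital_algebra_def DH2_def quantum_double_def by simp

lemma double_antipode_tensor:
  fixes h :: "'k ^ bit"
  shows "double_antipode H2 (\<phi> \<otimes> h) = (eps_H2 \<otimes> h) \<cdot>\<^bsub>DH2\<^esub> double_antipode H2 (\<phi> \<otimes> one_H2)"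
proof -
  have *: "double_antipode H2 (\<phi> \<otimes> h') =
    sw2 (f_elem H2) (\<lambda>f1 f2. sw2 (p_R H2) (\<lambda>p1 p2. sw2 (comult H2 p1) (\<lambda>p1_1 p1_2. sw2 (U_elem H2) (\<lambda>U1 U2.
      (eps_H2 \<otimes> (h' \<cdot>\<^bsub>H2\<^esub> f1)) \<cdot>\<^bsub>double_alg H2\<^esub>
        (act_left H2 (p1_1 \<cdot>\<^bsub>H2\<^esub> U1) (act_right H2 \<phi> (f2 \<cdot>\<^bsub>H2\<^esub> p2)) \<otimes> (p1_2 \<cdot>\<^bsub>H2\<^esub> U2))))))"
    for h' :: "'k ^ bit"
    unfolding double_antipode_def i_D_def eps_H2_def[symmetric] inv_dual_antipode sel_H2
    by (subst sw2_tensor, (intro D_lin_intros; fail)+) (rule refl)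
  show ?thesis
    unfolding *
    by (simp only: mul_sw unital_algebra_double_alg DH2_sel(1) double_mul_right H2_unit
      flip: unital_algebra_assoc[OF unital_algebra_DH2, unfolded DH2_sel(1)])
qed

lemma double_antipode_one_D: "double_antipode H2 (one_D :: 'k ^ (bit \<times> bit)) = one_D"
  unfolding double_antipode_def basis_double_defs i_D_def eps_H2_def[symmetric] inv_dual_antipode sel_H2
  apply (subst sw2_tensor, (intro D_lin_intros; fail)+)
  apply (subst sw2_f_elem_H2, (intro D_lin_intros; fail)+)+
  apply (subst sw2_p_R_H2, (intro D_lin_intros; fail)+)+
  apply (subst sw2_comult_H2, (intro D_lin_intros; fail)+)+
  apply (subst sw2_U_elem_H2, (intro D_lin_intros; fail)+)+
  by (simp add: double_mul_basis H2_eval D_distribs act_conv_distribs; simp add: vec_eq_iff)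

lemma double_antipode_y_D: "double_antipode H2 (y_D :: 'k ^ (bit \<times> bit)) = y_D"
  unfolding double_antipode_def basis_double_defs i_D_def eps_H2_def[symmetric] inv_dual_antipode sel_H2
  apply (subst sw2_tensor, (intro D_lin_intros; fail)+)
  apply (subst sw2_f_elem_H2, (intro D_lin_intros; fail)+)+
  apply (subst sw2_p_R_H2, (intro D_lin_intros; fail)+)+
  apply (subst sw2_comult_H2, (intro D_lin_intros; fail)+)+
  apply (subst sw2_U_elem_H2, (intro D_lin_intros; fail)+)+
  by (simp add: double_mul_basis H2_eval D_distribs act_conv_distribs; simp add: vec_eq_iff)

lemma double_antipode_basis: "double_antipode H2 (one_D :: 'k ^ (bit \<times> bit)) = one_D"
    "double_antipode H2 (p_D :: 'k ^ (bit \<times> bit)) = p_D"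
    "double_antipode H2 (y_D :: 'k ^ (bit \<times> bit)) = y_D"
    "double_antipode H2 (py_D :: 'k ^ (bit \<times> bit)) = py_D"
proof -
  show "double_antipode H2 (p_D :: 'k ^ (bit \<times> bit)) = p_D"
    unfolding p_D_def double_antipode_tensor[of eps_H2 p_H2]
    by (simp add: double_antipode_one_D mul_DH2 flip: basis_double_defs)
  show "double_antipode H2 (py_D :: 'k ^ (bit \<times> bit)) = py_D"
    unfolding py_D_def double_antipode_tensor[of chi_H2 p_H2]
    by (simp add: double_antipode_y_D mul_DH2 flip: basis_double_defs)
qed (fact double_antipode_one_D double_antipode_y_D)+

lemmas DH2_basis_maps = double_comult_one_D double_comult_p_D double_comult_y_D double_comult_py_D
  double_antipode_basis double_counit_basis

section \<open>Quasi-Hopf axioms and involutivity\<close>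

lemma alpha_DH2: "alpha DH2 = (one_D - 2 *s p_D :: 'k ^ (bit \<times> bit))"
  by (simp add: DH2_sel alpha_H2 tensor_distribs basis_double_defs)

lemma reassoc_DH2: "reassoc DH2 = (one_D \<otimes> one_D \<otimes> one_D - 2 *s (p_D \<otimes> p_D \<otimes> p_D)
    :: 'k ^ ((bit \<times> bit) \<times> (bit \<times> bit) \<times> (bit \<times> bit)))"
proof -
  have "reassoc DH2 = (sw3 (reassoc H2) (\<lambda>X1 X2 X3. (eps_H2 \<otimes> X1) \<otimes> (eps_H2 \<otimes> X2) \<otimes> (eps_H2 \<otimes> X3))
    :: 'k ^ ((bit \<times> bit) \<times> (bit \<times> bit) \<times> (bit \<times> bit)))"
    by (simp add: DH2_def quantum_double_def i_D_def eps_H2_def)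
  also have "\<dots> = one_D \<otimes> one_D \<otimes> one_D - 2 *s (p_D \<otimes> p_D \<otimes> p_D)"
    by (subst sw3_reassoc_H2, (intro H2_lin_intros; fail)+) (simp add: basis_double_defs)
  finally show ?thesis .
qed

lemmas DH2_eval = sw2_tensor sw3_tensor sw4_tensor unital_algebra_DH2 unital_algebra_tensor_alg mul_tensor_alg
  sw_distribs tensor_distribs mul_distribs mul_DH2 DH2_sel(2) DH2_sel(7) alpha_DH2 reassoc_DH2
  DH2_basis_maps[folded DH2_sel(3) DH2_sel(4) DH2_sel(5)]
  lin_map_distribs[OF lin_DH2_maps(1)] lin_map_distribs[OF lin_DH2_maps(2)]
  vector_smult_assoc numeral_mult_vec unit_tensor_alg

lemmas DH2_lin = lin_intros lin_mul unital_algebra_lin lin_map_tensor_const lin_map_const_tensor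
  lin_DH2_maps(1,2) lin_DH2_maps(1,2)[THEN lin_map_comp] lin_DH2_maps(3) lin_DH2_maps(3)[THEN lin_form_comp]
  lin_map_plus lin_map_subtract lin_map_uminus lin_map_const_zero

lemma reassoc_DH2_square: "(\<Phi>\<^bsub>DH2\<^esub> \<cdot>\<^bsub>T3 DH2\<^esub> \<Phi>\<^bsub>DH2\<^esub> :: 'k ^ ((bit \<times> bit) \<times> (bit \<times> bit) \<times> (bit \<times> bit))) = \<one>\<^bsub>T3 DH2\<^esub>"
  by (simp add: DH2_eval; simp add: vec_eq_iff)

lemma reassoc_inv_DH2: "reassoc_inv DH2 = (reassoc DH2 :: 'k ^ ((bit \<times> bit) \<times> (bit \<times> bit) \<times> (bit \<times> bit)))"
  unfolding reassoc_inv_def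
  by (intro alg_inv_eqI reassoc_DH2_square unital_algebra_tensor_alg unital_algebra_DH2)

lemma alg_unit_reassoc_DH2: "alg_unit (T3 DH2) (\<Phi>\<^bsub>DH2\<^esub> :: 'k ^ ((bit \<times> bit) \<times> (bit \<times> bit) \<times> (bit \<times> bit)))"
  unfolding alg_unit_def using reassoc_DH2_square by blast

lemma antipode_DH2: "\<S>\<^bsub>DH2\<^esub> x = (x :: 'k ^ (bit \<times> bit))"
  by (rule lin_map_eqI_double[of "\<S>\<^bsub>DH2\<^esub>" "\<lambda>x. x"]) (simp_all add: DH2_lin DH2_eval)

lemma comm_DH2_basis:
  assumes "a \<in> {one_D, p_D, y_D, py_D :: 'k ^ (bit \<times> bit)}" "b \<in> {one_D, p_D, y_D, py_D}"
  shows "a \<cdot>\<^bsub>DH2\<^esub> b = b \<cdot>\<^bsub>DH2\<^esub> a"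
  using assms by (elim insertE emptyE) (simp_all add: mul_DH2)

lemma lin_map_eqI_double2:
  assumes "\<And>y. lin_map (\<lambda>x. F x y)" "\<And>x. lin_map (F x)" "\<And>y. lin_map (\<lambda>x. G x y)" "\<And>x. lin_map (G x)"
    "\<And>a b. a \<in> {one_D, p_D, y_D, py_D} \<Longrightarrow> b \<in> {one_D, p_D, y_D, py_D} \<Longrightarrow> F a b = G a b"
  shows "F u v = G u (v :: 'k ^ (bit \<times> bit))"
  by (rule lin_map_eqI_double_basis[of "\<lambda>u. F u v" "\<lambda>u. G u v"], rule assms, rule assms,
     rule lin_map_eqI_double_basis[of "F _" "G _"], rule assms, rule assms, rule assms)

text \<open>The multiplication table is symmetric. Commutativity makes the identity, which is the
  antipode, an anti-morphism.\<close>

lemma comm_DH2: "x \<cdot>\<^bsub>DH2\<^esub> y = y \<cdot>\<^bsub>DH2\<^esub> (x :: 'k ^ (bit \<times> bit))"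
  by (rule lin_map_eqI_double2[of "\<lambda>x y. x \<cdot>\<^bsub>DH2\<^esub> y" "\<lambda>x y. y \<cdot>\<^bsub>DH2\<^esub> x"])
   (rule lin_DH2_mul comm_DH2_basis; assumption?)+

lemma comult_DH2_mul: "\<Delta>\<^bsub>DH2\<^esub> (x \<cdot>\<^bsub>DH2\<^esub> y) = \<Delta>\<^bsub>DH2\<^esub> x \<cdot>\<^bsub>T2 DH2\<^esub> \<Delta>\<^bsub>DH2\<^esub> (y :: 'k ^ (bit \<times> bit))"
proof (rule lin_map_eqI_double2[of "\<lambda>x y. \<Delta>\<^bsub>DH2\<^esub> (x \<cdot>\<^bsub>DH2\<^esub> y)" "\<lambda>x y. \<Delta>\<^bsub>DH2\<^esub> x \<cdot>\<^bsub>T2 DH2\<^esub> \<Delta>\<^bsub>DH2\<^esub> y"])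
  fix a b :: "'k ^ (bit \<times> bit)"
  assume "a \<in> {one_D, p_D, y_D, py_D}" "b \<in> {one_D, p_D, y_D, py_D}"
  then show "\<Delta>\<^bsub>DH2\<^esub> (a \<cdot>\<^bsub>DH2\<^esub> b) = \<Delta>\<^bsub>DH2\<^esub> a \<cdot>\<^bsub>T2 DH2\<^esub> \<Delta>\<^bsub>DH2\<^esub> b"
    apply (elim insertE emptyE)
    apply (simp only: , simp add: DH2_eval; simp add: vec_eq_iff)+
    done
qed (intro lin_DH2_maps(1,2)[THEN lin_map_comp] lin_mul lin_map_id unital_algebra_DH2 unital_algebra_tensor_alg; fail)+

lemma one_D_neq_zero: "one_D \<noteq> (0 :: 'k ^ (bit \<times> bit))"
  by (auto simp: one_D_def tensor_def vec_eq_iff eps_H2_nth one_H2_nth)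

text \<open>Scaling a nonzero vector turns the two bilinear forms into vector valued maps, to which \<open>lin_map_eqI_double2\<close> applies.\<close>

lemma counit_DH2_mul: "\<epsilon>\<^bsub>DH2\<^esub> (x \<cdot>\<^bsub>DH2\<^esub> y) = \<epsilon>\<^bsub>DH2\<^esub> x * \<epsilon>\<^bsub>DH2\<^esub> (y :: 'k ^ (bit \<times> bit))"
proof -
  have "\<epsilon>\<^bsub>DH2\<^esub> (x \<cdot>\<^bsub>DH2\<^esub> y) *s one_D = (\<epsilon>\<^bsub>DH2\<^esub> x * \<epsilon>\<^bsub>DH2\<^esub> y) *s (one_D :: 'k ^ (bit \<times> bit))"
  proof (rule lin_map_eqI_double2[of "\<lambda>x y. \<epsilon>\<^bsub>DH2\<^esub> (x \<cdot>\<^bsub>DH2\<^esub> y) *s one_D" "\<lambda>x y. (\<epsilon>\<^bsub>DH2\<^esub> x * \<epsilon>\<^bsub>DH2\<^esub> y) *s one_D"])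
    fix a b :: "'k ^ (bit \<times> bit)"
    assume "a \<in> {one_D, p_D, y_D, py_D}" "b \<in> {one_D, p_D, y_D, py_D}"
    then show "\<epsilon>\<^bsub>DH2\<^esub> (a \<cdot>\<^bsub>DH2\<^esub> b) *s one_D = (\<epsilon>\<^bsub>DH2\<^esub> a * \<epsilon>\<^bsub>DH2\<^esub> b) *s (one_D :: 'k ^ (bit \<times> bit))"
      by (elim insertE emptyE) (simp_all add: DH2_eval lin_form_distribs[OF lin_DH2_maps(3)])
  qed (intro lin_map_scale_form lin_form_mult lin_DH2_maps(3) lin_form_comp[OF lin_DH2_maps(3)] lin_DH2_mul; fail)+
  then show ?thesis
    by (simp add: one_D_neq_zero)
qed

text \<open>The reassociator stands on both sides because it is its own inverse.\<close>

lemma quasi_coassoc_DH2: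
  "sw2 (\<Delta>\<^bsub>DH2\<^esub> h) (\<lambda>h_1 h_2. h_1 \<otimes> \<Delta>\<^bsub>DH2\<^esub> h_2) =
      \<Phi>\<^bsub>DH2\<^esub> \<cdot>\<^bsub>T3 DH2\<^esub> sw2 (\<Delta>\<^bsub>DH2\<^esub> h) (\<lambda>h_1 h_2. sw2 (\<Delta>\<^bsub>DH2\<^esub> h_1) (\<lambda>h11 h12. h11 \<otimes> h12 \<otimes> h_2)) \<cdot>\<^bsub>T3 DH2\<^esub>
       (\<Phi>\<^bsub>DH2\<^esub> :: 'k ^ ((bit \<times> bit) \<times> (bit \<times> bit) \<times> (bit \<times> bit)))"
  by (rule lin_map_eqI_double[where f = "\<lambda>h. sw2 (\<Delta>\<^bsub>DH2\<^esub> h) (\<lambda>h_1 h_2. h_1 \<otimes> \<Delta>\<^bsub>DH2\<^esub> h_2)" and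
     g = "\<lambda>h. \<Phi>\<^bsub>DH2\<^esub> \<cdot>\<^bsub>T3 DH2\<^esub> sw2 (\<Delta>\<^bsub>DH2\<^esub> h) (\<lambda>h_1 h_2. sw2 (\<Delta>\<^bsub>DH2\<^esub> h_1) (\<lambda>h11 h12. h11 \<otimes> h12 \<otimes> h_2)) \<cdot>\<^bsub>T3 DH2\<^esub> \<Phi>\<^bsub>DH2\<^esub>"];
   (intro DH2_lin unital_algebra_DH2 unital_algebra_tensor_alg; fail)?; simp add: DH2_eval DH2_lin cong: sw_congs; simp add: vec_eq_iff)

text \<open>Only the unit and P occur, with the same coproducts as in H(2), so this is the 3-cocycle
  identity for the sign (-1)^(ijk) on the group of order two.\<close>

lemma pentagon_DH2:
  fixes P :: "'k ^ ((bit \<times> bit) \<times> (bit \<times> bit) \<times> (bit \<times> bit))"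
  assumes "P = reassoc DH2"
  shows "(one_D \<otimes> P)
      \<cdot>\<^bsub>T4 DH2\<^esub> sw3 P (\<lambda>X1 X2 X3. sw2 (\<Delta>\<^bsub>DH2\<^esub> X2) (\<lambda>X21 X22. X1 \<otimes> X21 \<otimes> X22 \<otimes> X3))
      \<cdot>\<^bsub>T4 DH2\<^esub> sw3 P (\<lambda>X1 X2 X3. X1 \<otimes> X2 \<otimes> X3 \<otimes> one_D)
    = sw3 P (\<lambda>X1 X2 X3. X1 \<otimes> X2 \<otimes> \<Delta>\<^bsub>DH2\<^esub> X3)
      \<cdot>\<^bsub>T4 DH2\<^esub> sw3 P (\<lambda>X1 X2 X3. sw2 (\<Delta>\<^bsub>DH2\<^esub> X1) (\<lambda>X11 X12. X11 \<otimes> X12 \<otimes> X2 \<otimes> X3))"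
  unfolding assms by (simp add: DH2_eval DH2_lin cong: sw_congs; simp add: vec_eq_iff)

lemma lin_map_eqI_double_self:
  assumes "lin_map f" "f one_D = one_D" "f p_D = p_D" "f y_D = y_D" "f py_D = py_D"
  shows "f u = (u :: 'k ^ (bit \<times> bit))"
  by (rule lin_map_eqI_double[of f "\<lambda>x. x"]) (simp_all add: assms lin_map_id)

lemma is_quasi_bialgebra_DH2: "is_quasi_bialgebra (DH2 :: ('k, bit \<times> bit) quasi_hopf)"
proof -
  let ?D = "DH2 :: ('k, bit \<times> bit) quasi_hopf"
  have 1: "sw2 (\<Delta>\<^bsub>?D\<^esub> h) (\<lambda>h_1 h_2. \<epsilon>\<^bsub>?D\<^esub> h_2 *s h_1) = h" for h
    by (rule lin_map_eqI_double_self[of "\<lambda>h. sw2 (\<Delta>\<^bsub>?D\<^esub> h) (\<lambda>h_1 h_2. \<epsilon>\<^bsub>?D\<^esub> h_2 *s h_1)"],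
      (intro DH2_lin; fail)?)
     (simp_all add: DH2_eval DH2_lin cong: sw_congs)
  have 2: "sw2 (\<Delta>\<^bsub>?D\<^esub> h) (\<lambda>h_1 h_2. \<epsilon>\<^bsub>?D\<^esub> h_1 *s h_2) = h" for h
    by (rule lin_map_eqI_double_self[of "\<lambda>h. sw2 (\<Delta>\<^bsub>?D\<^esub> h) (\<lambda>h_1 h_2. \<epsilon>\<^bsub>?D\<^esub> h_1 *s h_2)"],
      (intro DH2_lin; fail)?)
     (simp_all add: DH2_eval DH2_lin cong: sw_congs)
  have 3: "sw3 \<Phi>\<^bsub>?D\<^esub> (\<lambda>X1 X2 X3. \<epsilon>\<^bsub>?D\<^esub> X2 *s (X1 \<otimes> X3)) = \<one>\<^bsub>?D\<^esub> \<otimes> \<one>\<^bsub>?D\<^esub>"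
    by (simp add: DH2_eval DH2_lin cong: sw_congs)
  have 4: "alg_hom ?D (T2 ?D) \<Delta>\<^bsub>?D\<^esub>"
    by (simp add: alg_hom_def comult_DH2_mul lin_DH2_maps DH2_eval)
  have 5: "alg_character ?D \<epsilon>\<^bsub>?D\<^esub>"
    by (simp add: alg_character_def counit_DH2_mul lin_DH2_maps DH2_eval)
  show ?thesis
    unfolding is_quasi_bialgebra_def reassoc_inv_DH2
    using unital_algebra_DH2 alg_unit_reassoc_DH2 quasi_coassoc_DH2 pentagon_DH2[OF refl] 1 2 3 4 5
    by (simp only: DH2_sel(2)) blast
qed

lemma is_quasi_hopf_algebra_DH2: "is_quasi_hopf_algebra (DH2 :: ('k, bit \<times> bit) quasi_hopf)"
proof -
  let ?D = "DH2 :: ('k, bit \<times> bit) quasi_hopf"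
  \<comment> \<open>In the four antipode equations the antipode is left out and the reassociator
    stands for its inverse; \<open>antipode_DH2\<close> and \<open>reassoc_inv_DH2\<close> restore
    the official form at the end.\<close>
  have 1: "sw2 (\<Delta>\<^bsub>?D\<^esub> h) (\<lambda>h_1 h_2. h_1 \<cdot>\<^bsub>?D\<^esub> \<alpha>\<^bsub>?D\<^esub> \<cdot>\<^bsub>?D\<^esub> h_2) = \<epsilon>\<^bsub>?D\<^esub> h *s \<alpha>\<^bsub>?D\<^esub>" for h
    by (rule lin_map_eqI_double[of "\<lambda>h. sw2 (\<Delta>\<^bsub>?D\<^esub> h) (\<lambda>h_1 h_2. h_1 \<cdot>\<^bsub>?D\<^esub> \<alpha>\<^bsub>?D\<^esub> \<cdot>\<^bsub>?D\<^esub> h_2)" "\<lambda>h. \<epsilon>\<^bsub>?D\<^esub> h *s \<alpha>\<^bsub>?D\<^esub>"];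
        (intro DH2_lin; fail)?; simp add: DH2_eval DH2_lin cong: sw_congs; simp add: vec_eq_iff)
  have 2: "sw2 (\<Delta>\<^bsub>?D\<^esub> h) (\<lambda>h_1 h_2. h_1 \<cdot>\<^bsub>?D\<^esub> \<beta>\<^bsub>?D\<^esub> \<cdot>\<^bsub>?D\<^esub> h_2) = \<epsilon>\<^bsub>?D\<^esub> h *s \<beta>\<^bsub>?D\<^esub>" for h
    by (rule lin_map_eqI_double[of "\<lambda>h. sw2 (\<Delta>\<^bsub>?D\<^esub> h) (\<lambda>h_1 h_2. h_1 \<cdot>\<^bsub>?D\<^esub> \<beta>\<^bsub>?D\<^esub> \<cdot>\<^bsub>?D\<^esub> h_2)" "\<lambda>h. \<epsilon>\<^bsub>?D\<^esub> h *s \<beta>\<^bsub>?D\<^esub>"];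
        (intro DH2_lin; fail)?; simp add: DH2_eval DH2_lin cong: sw_congs; simp add: vec_eq_iff)
  have 3: "sw3 \<Phi>\<^bsub>?D\<^esub> (\<lambda>X1 X2 X3. X1 \<cdot>\<^bsub>?D\<^esub> \<beta>\<^bsub>?D\<^esub> \<cdot>\<^bsub>?D\<^esub> X2 \<cdot>\<^bsub>?D\<^esub> \<alpha>\<^bsub>?D\<^esub> \<cdot>\<^bsub>?D\<^esub> X3) = \<one>\<^bsub>?D\<^esub>"
    by (simp add: DH2_eval DH2_lin cong: sw_congs; simp add: vec_eq_iff)
  have 4: "sw3 \<Phi>\<^bsub>?D\<^esub> (\<lambda>x1 x2 x3. x1 \<cdot>\<^bsub>?D\<^esub> \<alpha>\<^bsub>?D\<^esub> \<cdot>\<^bsub>?D\<^esub> x2 \<cdot>\<^bsub>?D\<^esub> \<beta>\<^bsub>?D\<^esub> \<cdot>\<^bsub>?D\<^esub> x3) = \<one>\<^bsub>?D\<^esub>"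
    by (simp add: DH2_eval DH2_lin cong: sw_congs; simp add: vec_eq_iff)
  have 5: "alg_antihom ?D ?D \<S>\<^bsub>?D\<^esub>"
    unfolding alg_antihom_def using lin_DH2_maps(2) comm_DH2 by (simp add: antipode_DH2)
  show ?thesis
    unfolding is_quasi_hopf_algebra_def reassoc_inv_DH2
    using is_quasi_bialgebra_DH2 1 2 3 4 5 by (simp add: antipode_DH2)
qed

lemma is_involutory_DH2: "is_involutory (DH2 :: ('k, bit \<times> bit) quasi_hopf)"
proof -
  let ?D = "DH2 :: ('k, bit \<times> bit) quasi_hopf"
  \<comment> \<open>With trivial antipode and \<beta> = 1 the claim reads X h X = h, which holds
    since X is central and X^2 = 1.\<close>
  have "one_D \<cdot>\<^bsub>?D\<^esub> \<alpha>\<^bsub>?D\<^esub> \<cdot>\<^bsub>?D\<^esub> h \<cdot>\<^bsub>?D\<^esub> one_D \<cdot>\<^bsub>?D\<^esub> \<alpha>\<^bsub>?D\<^esub> = h" for h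
    by (rule lin_map_eqI_double_self[of "\<lambda>h. one_D \<cdot>\<^bsub>?D\<^esub> \<alpha>\<^bsub>?D\<^esub> \<cdot>\<^bsub>?D\<^esub> h \<cdot>\<^bsub>?D\<^esub> one_D \<cdot>\<^bsub>?D\<^esub> \<alpha>\<^bsub>?D\<^esub>"];
        (intro DH2_lin unital_algebra_DH2; fail)?; simp add: DH2_eval; simp add: vec_eq_iff)
  then show ?thesis
    by (simp add: is_involutory_def antipode_DH2 DH2_sel(7))
qed

section \<open>Coordinates and the presentation\<close>

lemma basis_double_nth:
  "(one_D :: 'k ^ (bit \<times> bit)) $ (i, j) = (if j = 0 then 1 else 0)"
  "(p_D :: 'k ^ (bit \<times> bit)) $ (i, j) = (if j = 0 then 1 / 2 else - 1 / 2)"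
  "(y_D :: 'k ^ (bit \<times> bit)) $ (i, j) = (if j = 0 then if i = 0 then 1 else - 1 else 0)"
  "(py_D :: 'k ^ (bit \<times> bit)) $ (i, j) = (if i = j then 1 / 2 else - 1 / 2)"
  by (cases i; cases j; simp add: basis_double_defs tensor_def eps_H2_nth chi_H2_nth one_H2_nth p_H2_nth)+

text \<open>In the first index half sums and half differences expand a functional in the characters;
  in the second index g = 1 - 2p is substituted.\<close>

lemma double_span: "u = ((u $ (0,0) + u $ (1,0) + u $ (0,1) + u $ (1,1)) / 2) *s one_D
    + (- (u $ (0,1) + u $ (1,1))) *s p_D
    + ((u $ (0,0) + u $ (0,1) - u $ (1,0) - u $ (1,1)) / 2) *s y_D
    + (u $ (1,1) - u $ (0,1)) *s (py_D :: 'k ^ (bit \<times> bit))"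
  using two_neq_zero powers_of_two_neq_zero by (simp add: vec_bit2_eq_iff basis_double_nth field_simps)

lemma double_coords:
  fixes a b c e :: 'k
  defines "u \<equiv> a *s one_D + b *s p_D + c *s y_D + e *s py_D"
  shows "a = (u $ (0,0) + u $ (1,0) + u $ (0,1) + u $ (1,1)) / 2" "b = - (u $ (0,1) + u $ (1,1))"
    "c = (u $ (0,0) + u $ (0,1) - u $ (1,0) - u $ (1,1)) / 2" "e = u $ (1,1) - u $ (0,1)"
  unfolding u_def using two_neq_zero powers_of_two_neq_zero by (simp_all add: basis_double_nth field_simps)

lemma double_independent:
  assumes "a *s one_D + b *s p_D + c *s y_D + e *s py_D = (0 :: 'k ^ (bit \<times> bit))"
  shows "a = 0 \<and> b = 0 \<and> c = 0 \<and> e = 0"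
  using double_coords[where a = a and b = b and c = c and e = e] unfolding assms by simp

lemma presented_by_DH2:
  fixes X Y :: "'k ^ (bit \<times> bit)"
  assumes X: "X = one_D - 2 *s p_D" and Y: "Y = y_D"
  shows "presented_by DH2 (case_generator X Y)
      {gen GX * gen GX - 1, gen GY * gen GY - gen GX, gen GX * gen GY - gen GY * gen GX}"
    (is "presented_by _ ?v ?R")
proof -
  let ?e = "free_eval DH2 ?v"
  note ev = free_eval_add free_eval_diff free_eval_mult free_eval_gen free_eval_one unital_algebra_DH2
    DH2_sel(2) mul_DH2 DH2_mul_distribs X Y vector_smult_assoc
  have pow: "?e (gen GY ^ n) = [one_D, y_D, one_D - 2 *s p_D, y_D - 2 *s py_D] ! n" if "n < 4" for n
  proof -
    have "n \<in> {0, 1, 2, 3}" using that by auto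
    then show ?thesis
      by (elim insertE emptyE) (simp_all add: ev power2_eq_square power3_eq_cube, (simp add: vec_eq_iff)?)
  qed
  have const: "?e (Poly_Mapping.single 0 c * q) = c *s ?e q" for c q
    by (simp add: free_eval_mult free_eval_single word_eval_def zero_free_monoid_def unital_algebra_DH2
        mul_distribs unital_algebra_unit)
  \<comment> \<open>By \<open>pow\<close>, Y^2 = 1 - 2P and Y^3 = Y - 2PY; collecting terms gives an
    invertible substitution of coefficients because 2 is invertible.\<close>
  have sum4: "?e (\<Sum>n<4. Poly_Mapping.single 0 (c n) * gen GY ^ n)
      = (c 0 + c 2) *s one_D + (- 2 * c 2) *s p_D + (c 1 + c 3) *s y_D + (- 2 * c 3) *s py_D" for c
    using const[of "c 0" 1] pow[of 0] pow[of 1]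
    by (simp add: lessThan_nat_numeral lessThan_Suc free_eval_add free_eval_zero const pow)
      (simp add: vec_eq_iff algebra_simps)
  have "surj ?e"
  proof (rule surjI)
    fix u :: "'k ^ (bit \<times> bit)"
    define a b c e where "a = (u $ (0,0) + u $ (1,0) + u $ (0,1) + u $ (1,1)) / 2"
      and "b = - (u $ (0,1) + u $ (1,1))"
      and "c = (u $ (0,0) + u $ (0,1) - u $ (1,0) - u $ (1,1)) / 2"
      and "e = u $ (1,1) - u $ (0,1)"
    have "u = a *s one_D + b *s p_D + c *s y_D + e *s py_D"
      using double_span[of u] by (simp only: a_def b_def c_def e_def)
    \<comment> \<open>The preimage solves the equations of \<open>sum4\<close>: the P and PY
      coordinates determine the coefficients of Y^2 and Y^3, then the remaining two follow.\<close>
    then show "?e (\<Sum>n<4. Poly_Mapping.single 0 ([a + b / 2, c + e / 2, - (b / 2), - (e / 2)] ! n) * gen GY ^ n) = u"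
      unfolding sum4 using two_neq_zero by simp
  qed
  moreover have "?R \<subseteq> {p. ?e p = 0}"
    by (auto simp: ev; simp add: vec_eq_iff)
  then have sub: "ideal_generated ?R \<subseteq> {p. ?e p = 0}"
    by (rule ideal_generated_least[OF two_sided_ideal_kernel[OF unital_algebra_DH2]])
  moreover have "p \<in> ideal_generated ?R" if p: "?e p = 0" for p
  proof -
    let ?I = "ideal_generated ?R"
    have I: "two_sided_ideal ?I"
      by (rule two_sided_ideal_ideal_generated)
    obtain c where c: "p - (\<Sum>n<4. Poly_Mapping.single 0 (c n) * gen GY ^ n) \<in> ?I"
      using congruent_cubic[OF I, of p] ideal_generated_superset[of ?R] by auto
    \<comment> \<open>The cubic differs from \<open>p\<close> by an element of the kernel, so it
      evaluates to zero as well, and independence of the basis kills its coefficients.\<close>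
    then have "?e (\<Sum>n<4. Poly_Mapping.single 0 (c n) * gen GY ^ n) = 0"
      using sub p by (auto simp: free_eval_diff)
    then have "c 0 + c 2 = 0 \<and> - 2 * c 2 = 0 \<and> c 1 + c 3 = 0 \<and> - 2 * c 3 = 0"
      unfolding sum4 by (rule double_independent)
    then have "c 0 = 0 \<and> c 1 = 0 \<and> c 2 = 0 \<and> c 3 = 0"
      using two_neq_zero by auto
    then have "(\<Sum>n<4. Poly_Mapping.single 0 (c n) * gen GY ^ n) = (0 :: (generator, 'k) free_algebra)"
      by (simp add: lessThan_nat_numeral lessThan_Suc)
    with c show ?thesis
      by simp
  qed
  ultimately show ?thesis
    unfolding presented_by_def using unital_algebra_DH2 by blast
qed

end

theorem proposition2p10:
  fixes D :: "('k::field, bit \<times> bit) quasi_hopf"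
  assumes "CHAR('k) \<noteq> 2"
    and D_def: "D = quantum_double (H2 :: ('k, bit) quasi_hopf)"
  shows "\<exists>X Y :: 'k ^ (bit \<times> bit).
    let XY = X \<cdot>\<^bsub>D\<^esub> Y in
    presented_by D (case_generator X Y)
      {gen GX * gen GX - 1, gen GY * gen GY - gen GX, gen GX * gen GY - gen GY * gen GX} \<and>
    \<Delta>\<^bsub>D\<^esub> X = X \<otimes> X \<and> \<epsilon>\<^bsub>D\<^esub> X = 1 \<and>
    \<Delta>\<^bsub>D\<^esub> Y = (- (1 / 2)) *s (Y \<otimes> Y + XY \<otimes> Y + Y \<otimes> XY - XY \<otimes> XY) \<and> \<epsilon>\<^bsub>D\<^esub> Y = - 1 \<and>
    \<Phi>\<^bsub>D\<^esub> = \<one>\<^bsub>T3 D\<^esub> - 2 *s (p_minus D X \<otimes> p_minus D X \<otimes> p_minus D X) \<and>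
    \<alpha>\<^bsub>D\<^esub> = X \<and> \<beta>\<^bsub>D\<^esub> = \<one>\<^bsub>D\<^esub> \<and> \<S>\<^bsub>D\<^esub> X = X \<and> \<S>\<^bsub>D\<^esub> Y = Y \<and>
    is_quasi_hopf_algebra D \<and> is_involutory D"
proof -
  interpret char_not_two "TYPE('k)"
    by standard (rule two_neq_zero_if_CHAR[OF assms(1)])
  have D: "D = DH2"
    by (simp add: D_def DH2_def)
  \<comment> \<open>X is the image of g under \<open>i_D\<close>, and Y is \<chi> \<bowtie>
    1.\<close>
  define X Y :: "'k ^ (bit \<times> bit)" where X: "X = one_D - 2 *s p_D" and Y: "Y = y_D"
  have XY: "X \<cdot>\<^bsub>DH2\<^esub> Y = y_D - 2 *s py_D"
    by (simp add: X Y mul_DH2 DH2_mul_distribs)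
  have "p_minus DH2 X = p_D"
    using two_neq_zero by (simp add: p_minus_def X DH2_sel(2) vec_eq_iff)
  then have \<Phi>: "\<Phi>\<^bsub>DH2\<^esub> = \<one>\<^bsub>T3 DH2\<^esub> - 2 *s (p_minus DH2 X \<otimes> p_minus DH2 X \<otimes> p_minus DH2 X)"
    by (simp add: reassoc_DH2 unit_tensor_alg DH2_sel(2))
  have \<Delta>X: "\<Delta>\<^bsub>DH2\<^esub> X = X \<otimes> X"
    by (simp add: X DH2_eval; simp add: vec_eq_iff)
  \<comment> \<open>Inserting XY = Y - 2PY, the mixed terms cancel and the bracket becomes 2 Y
    \<otimes> Y - 4 PY \<otimes> PY, which is -2 times the computed coproduct.\<close>
  have \<Delta>Y: "\<Delta>\<^bsub>DH2\<^esub> Y = (- (1 / 2)) *s (Y \<otimes> Y + (X \<cdot>\<^bsub>DH2\<^esub> Y) \<otimes> Y + Y \<otimes> (X \<cdot>\<^bsub>DH2\<^esub> Y)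
      - (X \<cdot>\<^bsub>DH2\<^esub> Y) \<otimes> (X \<cdot>\<^bsub>DH2\<^esub> Y))"
    unfolding XY using two_neq_zero by (simp add: Y DH2_eval) (simp add: vec_eq_iff field_simps)
  have \<epsilon>: "\<epsilon>\<^bsub>DH2\<^esub> X = 1" "\<epsilon>\<^bsub>DH2\<^esub> Y = - 1"
    by (simp_all add: X Y DH2_eval lin_form_distribs[OF lin_DH2_maps(3)])
  show ?thesis
    unfolding D Let_def
    using presented_by_DH2[OF X Y] \<Delta>X \<Delta>Y \<epsilon> \<Phi> is_quasi_hopf_algebra_DH2 is_involutory_DH2
    by (intro exI[of _ X] exI[of _ Y]) (simp add: antipode_DH2 alpha_DH2 DH2_sel(2,7) flip: X)
qed

end
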